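(* Let $(R,\mathfrak m)$ be a Noetherian local ring of dimension $d\ge1$ with infinite residue field. Let $I$ be an $\mathfrak m$-primary ideal and $J$ a minimal reduction of $I$. Then there exists a minimal reduction $Q$ of $I$ such that \[ \operatorname{red}_Q(I)\le\max\{d\cdot\lambda(R/J)-2d+1,\;0\}. \]
   Context: $\lambda$ denotes length. A reduction of $I$ is an ideal $Q\subseteq I$ with $I^{r+1}=QI^r$ for some $r\ge0$; a minimal reduction is one minimal with respect to inclusion (for infinite residue field it is generated by $d$ elements forming a system of parameters). $\operatorname{red}_Q(I)$ is the least $r\ge0$ with $I^{r+1}=QI^r$. *)

theory Defs
  imports "HOL-Algebra.Ring_Divisibility" "HOL-Algebra.Ideal_Product" "HOL-Algebra.QuotRing"
    "HOL-Library.Extended_Nat"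
begin

primrec ideal_pow :: "('a, 'b) ring_scheme \<Rightarrow> 'a set \<Rightarrow> nat \<Rightarrow> 'a set" where
  "ideal_pow R I 0 = carrier R"
| "ideal_pow R I (Suc n) = ideal_prod R I (ideal_pow R I n)"

definition local_ring :: "('a, 'b) ring_scheme \<Rightarrow> 'a set \<Rightarrow> bool" where
  "local_ring R m \<longleftrightarrow> cring R \<and> maximalideal m R \<and> (\<forall>M. maximalideal M R \<longrightarrow> M = m)"

definition krull_dim :: "('a, 'b) ring_scheme \<Rightarrow> enat" where
  "krull_dim R = Sup {enat n | n. \<exists>P :: nat \<Rightarrow> 'a set.
      (\<forall>i\<le>n. primeideal (P i) R) \<and> (\<forall>i<n. P i \<subset> P (Suc i))}"

text \<open>Length of the R-module R/J: supremum of lengths n of strict chains of ideals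
  J = I_0 < I_1 < ... < I_n = R (submodules of R/J correspond to ideals containing J).\<close>
definition quot_length :: "('a, 'b) ring_scheme \<Rightarrow> 'a set \<Rightarrow> enat" where
  "quot_length R J = Sup {enat n | n. \<exists>C :: nat \<Rightarrow> 'a set.
      (\<forall>i\<le>n. ideal (C i) R) \<and> C 0 = J \<and> C n = carrier R \<and> (\<forall>i<n. C i \<subset> C (Suc i))}"

definition ideal_radical :: "('a, 'b) ring_scheme \<Rightarrow> 'a set \<Rightarrow> 'a set" where
  "ideal_radical R I = {x \<in> carrier R. \<exists>n::nat. x [^]\<^bsub>R\<^esub> n \<in> I}"

definition primary_to :: "('a, 'b) ring_scheme \<Rightarrow> 'a set \<Rightarrow> 'a set \<Rightarrow> bool" where
  "primary_to R m I \<longleftrightarrow> ideal I R \<and> ideal_radical R I = m"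

definition is_reduction :: "('a, 'b) ring_scheme \<Rightarrow> 'a set \<Rightarrow> 'a set \<Rightarrow> bool" where
  "is_reduction R Q I \<longleftrightarrow> ideal Q R \<and> Q \<subseteq> I \<and>
     (\<exists>r::nat. ideal_pow R I (Suc r) = ideal_prod R Q (ideal_pow R I r))"

definition is_minimal_reduction :: "('a, 'b) ring_scheme \<Rightarrow> 'a set \<Rightarrow> 'a set \<Rightarrow> bool" where
  "is_minimal_reduction R Q I \<longleftrightarrow> is_reduction R Q I \<and>
     (\<forall>Q'. is_reduction R Q' I \<and> Q' \<subseteq> Q \<longrightarrow> Q' = Q)"

definition reduction_number :: "('a, 'b) ring_scheme \<Rightarrow> 'a set \<Rightarrow> 'a set \<Rightarrow> nat" where
  "reduction_number R Q I = (LEAST r. ideal_pow R I (Suc r) = ideal_prod R Q (ideal_pow R I r))"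

end

theory Submission
  imports Defs
begin

text \<open>
  Let \<open>s\<close> be the least number of generators of an ideal containing a power of \<open>m\<close>. Prime avoidance
  gives \<open>s \<le> d\<close>, and this inequality suffices: for \<open>\<lambda>(R/J) \<ge> 2\<close> the bound is monotone in \<open>d\<close>, so
  Krull's height theorem is not needed (and \<open>\<lambda>(R/J) = 1\<close> forces \<open>J = m = I\<close>).

  Let \<open>q = (x\<^sub>1, \<dots>, x\<^sub>s) \<subseteq> I\<close> have finite colength \<open>e\<close>, and put \<open>L = (x\<^sub>1, \<dots>, x\<^sub>s\<^sub>-\<^sub>1)\<close>, \<open>x = x\<^sub>s\<close>. Modulo
  \<open>L\<^sup>n \<subseteq> I\<^sup>n\<close> the number of generators of \<open>I\<^sup>n\<close> is at most
  \<open>\<lambda>(I\<^sup>n / x I\<^sup>n + L\<^sup>n) \<le> \<lambda>(R / x R + L\<^sup>n)\<close>, whence \<open>\<mu>(I\<^sup>n) \<le> e \<cdot> C(n+s-2, n-1) + C(n+s-2, n)\<close>.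
  As soon as \<open>n > s e - 2 s + 1\<close> this is less than \<open>C(n+s, s)\<close>, and the Eakin--Sathaye theorem yields
  \<open>y\<^sub>1, \<dots>, y\<^sub>s \<in> I\<close> with \<open>I\<^sup>n = (y\<^sub>1, \<dots>, y\<^sub>s) I\<^sup>n\<^sup>-\<^sup>1\<close>. Applied to \<open>J\<close> itself (for any \<open>q \<subseteq> J\<close>) this shows
  that the minimal reduction \<open>J\<close> has \<open>s\<close> generators; applied to \<open>I\<close> with \<open>q = J\<close> it gives \<open>Q\<close>, which is a
  minimal reduction because a strictly smaller one would produce an ideal generated by fewer than
  \<open>s\<close> elements and containing a power of \<open>m\<close>.
\<close>

section \<open>Arithmetic of ideals\<close>

text \<open>Two features of the setting shape the proof. Elements may be zero divisors, so
  multiplication by \<open>y\<close> cannot be treated as injective; each use of it is measured by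
  the colon ideal (N : y) \<inter> B, for which \<open>len_dilate\<close> gives an exact length
  formula. And in the Eakin--Sathaye induction the recursive call yields a sequence \<open>y\<close>
  for one element \<open>z\<close> at a time, while a single sequence has to serve all generators of
  \<open>I\<close>. This is what calls for generic choices and hence for the infinite residue field,
  which gives prime avoidance by the same means. The number of generators of I^n is read off as the
  length of I^n / m I^n. With n = k + 1 and s = p + 1, the comparison of binomials is equivalent to
  the linear inequality \<open>Suc p * e < k + 2 * Suc p\<close>. Its least solution for e \<ge> 2
  is k = s (e - 2) + 1, and this exponent k, not n, bounds the reduction number.\<close>

no_notation Sum_Type.Plus (infixr \<open><+>\<close> 65)

context cring
begin

lemma set_add_iff: "x \<in> A <+> B \<longleftrightarrow> (\<exists>a\<in>A. \<exists>b\<in>B. x = a \<oplus> b)"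
  by (auto simp: set_add_def')

lemma set_add_least:
  assumes "ideal C R" "A \<subseteq> C" "B \<subseteq> C"
  shows "A <+> B \<subseteq> C"
  using assms(2,3) additive_subgroup.a_closed[OF ideal.axioms(1)[OF assms(1)]]
  by (auto simp: set_add_iff subset_iff)

lemma set_add_upper:
  assumes "ideal A R" "ideal B R"
  shows "A \<subseteq> A <+> B" "B \<subseteq> A <+> B"
proof -
  have z: "\<zero> \<in> A" "\<zero> \<in> B"
    using assms by (simp_all add: additive_subgroup.zero_closed ideal.axioms(1))
  show "A \<subseteq> A <+> B"
    using z by (auto simp: set_add_iff) (metis assms(1) ideal.Icarr r_zero)
  show "B \<subseteq> A <+> B"
    using z by (auto simp: set_add_iff) (metis assms(2) ideal.Icarr l_zero)
qed

lemma set_add_absorb: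
  assumes "ideal A R" "ideal B R" "A \<subseteq> B"
  shows "A <+> B = B" "B <+> A = B"
  using set_add_least[OF assms(2,3) subset_refl] set_add_least[OF assms(2) subset_refl assms(3)]
    set_add_upper[OF assms(1,2)] set_add_upper[OF assms(2,1)]
  by (simp_all add: subset_antisym)

lemma set_add_mono: "A \<subseteq> A' \<Longrightarrow> B \<subseteq> B' \<Longrightarrow> A <+> B \<subseteq> A' <+> B'"
  by (auto simp: set_add_iff subset_iff)

lemma ideal_subset_carrier: "ideal A R \<Longrightarrow> A \<subseteq> carrier R"
  using ideal.Icarr[of A R] by blast

lemma set_add_assoc:
  assumes "A \<subseteq> carrier R" "B \<subseteq> carrier R" "C \<subseteq> carrier R"
  shows "A <+> B <+> C = A <+> (B <+> C)"
  using add.set_mult_assoc assms by (simp add: set_add_defs(1))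

lemma ideal_prod_least:
  assumes "ideal C R" "\<And>a b. a \<in> A \<Longrightarrow> b \<in> B \<Longrightarrow> a \<otimes> b \<in> C"
  shows "A \<cdot> B \<subseteq> C"
proof
  fix x assume "x \<in> A \<cdot> B"
  then show "x \<in> C"
    by induct (auto intro: assms additive_subgroup.a_closed[OF ideal.axioms(1)])
qed

lemma ideal_prod_mono:
  assumes "A \<subseteq> A'" "B \<subseteq> B'"
  shows "A \<cdot> B \<subseteq> A' \<cdot> B'"
proof
  fix x assume "x \<in> A \<cdot> B"
  then show "x \<in> A' \<cdot> B'"
  proof induct
    case (prod i j)
    then show ?case using assms by (blast intro: ideal_prod.prod)
  next
    case (sum s1 s2)
    then show ?case by (blast intro: ideal_prod.sum)
  qed
qed

lemma ideal_prod_left_commute: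
  assumes "ideal A R" "ideal B R" "ideal C R"
  shows "A \<cdot> (B \<cdot> C) = B \<cdot> (A \<cdot> C)"
  using ideal_prod_assoc[OF assms] ideal_prod_assoc[OF assms(2,1,3)]
    ideal_prod_commute[OF assms(1,2)] by simp

lemma ideal_prod_carrier_left: "ideal A R \<Longrightarrow> carrier R \<cdot> A = A"
  using ideal_prod_commute[OF oneideal, of A] ideal_prod_one[of A] by simp

lemma ideal_pow_ideal: "ideal I R \<Longrightarrow> ideal (ideal_pow R I n) R"
  by (induct n) (auto intro: oneideal ideal_prod_is_ideal)

lemma ideal_pow_add:
  assumes "ideal I R"
  shows "ideal_pow R I (a + b) = ideal_pow R I a \<cdot> ideal_pow R I b"
  by (induct a)
    (simp_all add: assms ideal_pow_ideal ideal_prod_carrier_left ideal_prod_assoc)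

lemma ideal_pow_one: "ideal I R \<Longrightarrow> ideal_pow R I (Suc 0) = I"
  by (simp add: ideal_prod_one)

lemma ideal_pow_mono: "I \<subseteq> J \<Longrightarrow> ideal_pow R I n \<subseteq> ideal_pow R J n"
  by (induct n) (simp_all add: ideal_prod_mono)

lemma ideal_pow_antimono:
  assumes "ideal I R" "a \<le> b"
  shows "ideal_pow R I b \<subseteq> ideal_pow R I a"
proof -
  obtain c where "b = a + c" using assms(2) le_Suc_ex by blast
  then show ?thesis
    using ideal_prod_inter[of "ideal_pow R I a" "ideal_pow R I c"]
    by (simp add: assms ideal_pow_add ideal_pow_ideal)
qed

lemma ideal_pow_mult:
  assumes "ideal I R"
  shows "ideal_pow R (ideal_pow R I a) b = ideal_pow R I (a * b)"
  by (induct b) (simp_all add: assms ideal_pow_add ideal_pow_ideal)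

lemma prime_contains_power:
  assumes "primeideal P R" "ideal A R" "ideal_pow R A n \<subseteq> P"
  shows "A \<subseteq> P"
  using assms(3)
proof (induct n)
  case 0
  then show ?case
    using ideal_subset_carrier[OF assms(2)] by auto
next
  case (Suc n)
  then show ?case
    using primeideal_divides_ideal_prod[OF assms(1,2) ideal_pow_ideal[OF assms(2)]] by auto
qed

text \<open>The binomial expansion of a power of a sum, organised as an induction with an extra factor.\<close>

lemma power_sum_subset_aux:
  assumes "ideal A R" "ideal B R" "ideal I R" "ideal C R"
    and "ideal_pow R A a \<cdot> C \<subseteq> I" "ideal_pow R B b \<cdot> C \<subseteq> I"
  shows "ideal_pow R (A <+> B) (a + b) \<cdot> C \<subseteq> I"
  using assms(4-6)
proof (induct "a + b" arbitrary: a b C)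
  case 0
  then show ?case by simp
next
  case (Suc n)
  let ?S = "A <+> B"
  have iS: "ideal ?S R" by (simp add: add_ideals assms)
  note ids = assms(1-3) \<open>ideal C R\<close> iS
  show ?case
  proof (cases "a = 0 \<or> b = 0")
    case True
    then have "C \<subseteq> I"
      using Suc.prems by (auto simp: ideal_prod_carrier_left)
    moreover have "ideal_pow R ?S (a + b) \<cdot> C \<subseteq> C"
      using ideal_prod_inter[OF ideal_pow_ideal[OF iS] \<open>ideal C R\<close>] by blast
    ultimately show ?thesis by blast
  next
    case False
    then obtain a' b' where ab: "a = Suc a'" "b = Suc b'"
      by (metis not0_implies_Suc)
    have n: "n = a' + b" "n = a + b'" using Suc.hyps(2) ab by auto
    have "ideal_pow R ?S n \<cdot> (A \<cdot> C) \<subseteq> I"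
    proof -
      have "ideal_pow R B b \<cdot> (A \<cdot> C) \<subseteq> ideal_pow R B b \<cdot> C"
        using ideal_prod_mono[of "ideal_pow R B b" "ideal_pow R B b" "A \<cdot> C" C]
          ideal_prod_inter[of A C] ids by blast
      moreover have "ideal_pow R A a' \<cdot> (A \<cdot> C) = ideal_pow R A a \<cdot> C"
        by (simp add: ab ids ideal_pow_ideal ideal_prod_assoc ideal_prod_left_commute)
      ultimately show ?thesis
        using Suc.hyps(1)[OF n(1), of "A \<cdot> C"] Suc.prems ids n by (auto simp: ideal_prod_is_ideal)
    qed
    moreover have "ideal_pow R ?S n \<cdot> (B \<cdot> C) \<subseteq> I"
    proof -
      have "ideal_pow R A a \<cdot> (B \<cdot> C) \<subseteq> ideal_pow R A a \<cdot> C"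
        using ideal_prod_mono[of "ideal_pow R A a" "ideal_pow R A a" "B \<cdot> C" C]
          ideal_prod_inter[of B C] ids by blast
      moreover have "ideal_pow R B b' \<cdot> (B \<cdot> C) = ideal_pow R B b \<cdot> C"
        by (simp add: ab ids ideal_pow_ideal ideal_prod_assoc ideal_prod_left_commute)
      ultimately show ?thesis
        using Suc.hyps(1)[OF n(2), of "B \<cdot> C"] Suc.prems ids n by (auto simp: ideal_prod_is_ideal)
    qed
    ultimately have "ideal_pow R ?S n \<cdot> (A \<cdot> C) <+> ideal_pow R ?S n \<cdot> (B \<cdot> C) \<subseteq> I"
      by (intro set_add_least assms)
    moreover have "ideal_pow R ?S (a + b) \<cdot> C
        = ideal_pow R ?S n \<cdot> (A \<cdot> C) <+> ideal_pow R ?S n \<cdot> (B \<cdot> C)"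
    proof -
      have "ideal_pow R ?S (a + b) \<cdot> C = ideal_pow R ?S n \<cdot> (?S \<cdot> C)"
        by (simp add: Suc.hyps(2)[symmetric] ids ideal_pow_ideal ideal_prod_assoc
            ideal_prod_left_commute)
      then show ?thesis
        by (simp add: ids ideal_prod_distr ideal_pow_ideal ideal_prod_is_ideal)
    qed
    ultimately show ?thesis by simp
  qed
qed

lemma power_sum_subset:
  assumes "ideal A R" "ideal B R" "ideal I R"
    and "ideal_pow R A a \<subseteq> I" "ideal_pow R B b \<subseteq> I"
  shows "ideal_pow R (A <+> B) (a + b) \<subseteq> I"
  using power_sum_subset_aux[OF assms(1-3) oneideal, of a b] assms
  by (simp add: ideal_prod_one ideal_pow_ideal add_ideals)

end

text \<open>The coefficient ideal \<open>B\<close> is a parameter so that the sum of the y_i I^k can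
  be handled one term at a time: the recursion peels off the last term when \<open>s\<close> is
  lowered and when a family is perturbed. Only the first \<open>k\<close> values of the sequence
  matter.\<close>

primrec span_by :: "('a, 'b) ring_scheme \<Rightarrow> (nat \<Rightarrow> 'a) \<Rightarrow> nat \<Rightarrow> 'a set \<Rightarrow> 'a set" where
  "span_by R y 0 B = {\<zero>\<^bsub>R\<^esub>}"
| "span_by R y (Suc k) B = span_by R y k B <+>\<^bsub>R\<^esub> (\<lambda>b. y k \<otimes>\<^bsub>R\<^esub> b) ` B"

abbreviation gen_by :: "('a, 'b) ring_scheme \<Rightarrow> (nat \<Rightarrow> 'a) \<Rightarrow> nat \<Rightarrow> 'a set" where
  "gen_by R y k \<equiv> span_by R y k (carrier R)"

section \<open>Ideals generated by finite sequences\<close>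

context cring
begin

lemma dilate_ideal:
  assumes "x \<in> carrier R" "ideal B R"
  shows "ideal ((\<lambda>b. x \<otimes> b) ` B) R"
proof (rule idealI)
  show "ring R" by (rule ring_axioms)
  interpret B: ideal B R by fact
  have c: "b \<in> carrier R" if "b \<in> B" for b using that by (rule B.Icarr)
  show "subgroup ((\<lambda>b. x \<otimes> b) ` B) (add_monoid R)"
  proof (rule add.subgroupI)
    show "(\<lambda>b. x \<otimes> b) ` B \<subseteq> carrier R" using assms(1) c by blast
    show "(\<lambda>b. x \<otimes> b) ` B \<noteq> {}" using B.zero_closed by blast
  next
    fix a assume "a \<in> (\<lambda>b. x \<otimes> b) ` B"
    then obtain b where b: "b \<in> B" "a = x \<otimes> b" by blast
    then have "\<ominus> a = x \<otimes> (\<ominus> b)" using assms(1) c by (simp add: r_minus)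
    then show "\<ominus> a \<in> (\<lambda>b. x \<otimes> b) ` B" using B.a_inv_closed[OF b(1)] by blast
  next
    fix a a' assume "a \<in> (\<lambda>b. x \<otimes> b) ` B" "a' \<in> (\<lambda>b. x \<otimes> b) ` B"
    then obtain b b' where b: "b \<in> B" "a = x \<otimes> b" "b' \<in> B" "a' = x \<otimes> b'" by blast
    then have "a \<oplus> a' = x \<otimes> (b \<oplus> b')" using assms(1) c by (simp add: r_distr)
    then show "a \<oplus> a' \<in> (\<lambda>b. x \<otimes> b) ` B" using B.a_closed[OF b(1,3)] by blast
  qed
  fix a r assume "a \<in> (\<lambda>b. x \<otimes> b) ` B" and r: "r \<in> carrier R"
  then obtain b where b: "b \<in> B" "a = x \<otimes> b" by blast
  then have "r \<otimes> a = x \<otimes> (r \<otimes> b)" "a \<otimes> r = x \<otimes> (r \<otimes> b)"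
    using r assms(1) c[OF b(1)] by (simp_all add: m_lcomm m_comm)
  moreover have "r \<otimes> b \<in> B" using B.I_l_closed[OF b(1) r] .
  ultimately show "r \<otimes> a \<in> (\<lambda>b. x \<otimes> b) ` B" "a \<otimes> r \<in> (\<lambda>b. x \<otimes> b) ` B" by blast+
qed

lemma span_by_ideal:
  assumes "\<And>i. i < k \<Longrightarrow> y i \<in> carrier R" "ideal B R"
  shows "ideal (span_by R y k B) R"
  using assms(1)
proof (induct k)
  case 0
  show ?case using zeroideal by simp
next
  case (Suc k)
  have "ideal (span_by R y k B) R" by (rule Suc.hyps, rule Suc.prems) simp
  moreover have "ideal ((\<lambda>b. y k \<otimes> b) ` B) R" by (rule dilate_ideal[OF Suc.prems assms(2)]) simp
  ultimately show ?case unfolding span_by.simps by (rule add_ideals)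
qed

lemma span_by_cong:
  "(\<And>i. i < k \<Longrightarrow> y i = y' i) \<Longrightarrow> span_by R y k B = span_by R y' k B"
proof (induct k)
  case (Suc k)
  have "span_by R y k B = span_by R y' k B" by (rule Suc.hyps, rule Suc.prems) simp
  moreover have "y k = y' k" by (rule Suc.prems) simp
  ultimately show ?case by simp
qed simp

lemma span_by_least:
  assumes "ideal C R" "\<And>i b. i < k \<Longrightarrow> b \<in> B \<Longrightarrow> y i \<otimes> b \<in> C"
  shows "span_by R y k B \<subseteq> C"
  using assms(2)
proof (induct k)
  case 0
  then show ?case
    by (simp add: additive_subgroup.zero_closed[OF ideal.axioms(1)[OF assms(1)]])
next
  case (Suc k)
  then show ?case
    unfolding span_by.simps by (intro set_add_least[OF assms(1)]) auto
qed

lemma span_by_upper: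
  assumes "\<And>i. i < k \<Longrightarrow> y i \<in> carrier R" "ideal B R" "i < k" "b \<in> B"
  shows "y i \<otimes> b \<in> span_by R y k B"
  using assms(1,3)
proof (induct k)
  case (Suc k)
  have id: "ideal (span_by R y k B) R" "ideal ((\<lambda>b. y k \<otimes> b) ` B) R"
    using Suc.prems by (simp_all add: span_by_ideal dilate_ideal assms(2))
  show ?case
  proof (cases "i = k")
    case True
    then show ?thesis using set_add_upper(2)[OF id] assms(4) by auto
  next
    case False
    then show ?thesis using set_add_upper(1)[OF id] Suc by auto
  qed
qed simp

lemma gen_by_upper:
  assumes "\<And>i. i < k \<Longrightarrow> y i \<in> carrier R" "i < k"
  shows "y i \<in> gen_by R y k"
  using span_by_upper[of k y "carrier R" i "\<one>"] assms by (simp add: oneideal)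

lemma gen_by_least:
  assumes "ideal C R" "\<And>i. i < k \<Longrightarrow> y i \<in> C"
  shows "gen_by R y k \<subseteq> C"
  by (intro span_by_least assms) (auto simp: assms ideal.I_r_closed)

text \<open>The factors that carry \<open>b\<close> into \<open>N\<close> form an ideal, so a
  statement about all products \<open>a \<otimes> b\<close> with \<open>a\<close> in an ideal can be
  tested on its generators.\<close>

lemma colon_ideal:
  assumes "ideal N R" "b \<in> carrier R"
  shows "ideal {a \<in> carrier R. a \<otimes> b \<in> N} R"
proof (rule idealI)
  interpret N: ideal N R by fact
  show "ring R" by (rule ring_axioms)
  show "subgroup {a \<in> carrier R. a \<otimes> b \<in> N} (add_monoid R)"
  proof (rule add.subgroupI)
    show "{a \<in> carrier R. a \<otimes> b \<in> N} \<noteq> {}"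
      using assms(2) by (auto intro!: exI[of _ \<zero>])
  qed (use assms(2) in \<open>auto simp: l_distr l_minus\<close>)
  fix a x assume "a \<in> {a \<in> carrier R. a \<otimes> b \<in> N}" and x: "x \<in> carrier R"
  then have a: "a \<in> carrier R" "a \<otimes> b \<in> N" by auto
  then have "x \<otimes> a \<otimes> b \<in> N" using x assms(2) by (simp add: m_assoc N.I_l_closed)
  then show "x \<otimes> a \<in> {a \<in> carrier R. a \<otimes> b \<in> N}" "a \<otimes> x \<in> {a \<in> carrier R. a \<otimes> b \<in> N}"
    using a x by (simp_all add: m_comm)
qed

lemma span_by_eq_prod:
  assumes "\<And>i. i < k \<Longrightarrow> y i \<in> carrier R" "ideal B R"
  shows "span_by R y k B = gen_by R y k \<cdot> B"
proof
  have id: "ideal (span_by R y k B) R" "ideal (gen_by R y k) R"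
    by (intro span_by_ideal oneideal assms; assumption)+
  have gy: "y i \<in> gen_by R y k" if "i < k" for i
    by (rule gen_by_upper[OF assms(1) that])
  show "span_by R y k B \<subseteq> gen_by R y k \<cdot> B"
  proof (rule span_by_least)
    show "ideal (gen_by R y k \<cdot> B) R"
      by (rule ideal_prod_is_ideal[OF id(2) assms(2)])
  qed (intro ideal_prod.prod gy; assumption)
  show "gen_by R y k \<cdot> B \<subseteq> span_by R y k B"
  proof (rule ideal_prod_least[OF id(1)])
    fix a b assume "a \<in> gen_by R y k" and b: "b \<in> B"
    \<comment> \<open>\<open>Q\<close> is an ideal, so it contains \<open>gen_by R y k\<close> as
      soon as it contains each \<open>y i\<close>.\<close>
    define Q where "Q = {a \<in> carrier R. a \<otimes> b \<in> span_by R y k B}"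
    have bc: "b \<in> carrier R" by (rule ideal.Icarr[OF assms(2) b])
    have "ideal Q R"
      unfolding Q_def by (rule colon_ideal) (fact id(1) bc)+
    then have "gen_by R y k \<subseteq> Q"
    proof (rule gen_by_least)
      fix i assume i: "i < k"
      show "y i \<in> Q"
        unfolding Q_def using span_by_upper[of k y B i b, OF assms(1) assms(2) i b] assms(1)[OF i]
        by blast
    qed
    then show "a \<otimes> b \<in> span_by R y k B"
      using \<open>a \<in> _\<close> by (auto simp: Q_def)
  qed
qed

lemma gen_by_finite:
  assumes "finite Z" "Z \<subseteq> carrier R"
  shows "\<exists>y k. (\<forall>i<k. y i \<in> Z) \<and> gen_by R y k = Idl Z"
proof -
  obtain y and k :: nat where y: "Z = y ` {i. i < k}"
    using assms(1) finite_imp_nat_seg_image_inj_on by blast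
  have yc: "y i \<in> carrier R" if "i < k" for i using that assms(2) y by auto
  have "gen_by R y k = Idl Z"
  proof
    show "gen_by R y k \<subseteq> Idl Z"
      by (rule gen_by_least) (use genideal_self[OF assms(2)] y genideal_ideal[OF assms(2)] in auto)
    show "Idl Z \<subseteq> gen_by R y k"
    proof (rule genideal_minimal)
      show "ideal (gen_by R y k) R" by (rule span_by_ideal[OF yc oneideal])
      show "Z \<subseteq> gen_by R y k" using gen_by_upper[of k y, OF yc] y by blast
    qed
  qed
  then show ?thesis using y by (intro exI[of _ y] exI[of _ k]) auto
qed

end

section \<open>Length\<close>

text \<open>Lengths are suprema, for which only finite lower bounds have a direct meaning in terms
  of chains; inequalities and equations of lengths are therefore reduced to such bounds.\<close>

lemma enat_leI:
  assumes "\<And>k. enat k \<le> x \<Longrightarrow> enat k \<le> y"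
  shows "x \<le> y"
proof (cases x)
  case (enat a)
  then show ?thesis using assms[of a] by simp
next
  case infinity
  \<comment> \<open>A finite \<open>y\<close> is refuted by testing its successor.\<close>
  then show ?thesis using assms[of "Suc (the_enat y)"] by (cases y) auto
qed

lemma enat_eqI: "(\<And>k. enat k \<le> x \<longleftrightarrow> enat k \<le> y) \<Longrightarrow> x = y"
  by (rule order_antisym; rule enat_leI) simp_all

lemma enat_le_add_iff:
  "enat k \<le> x + y \<longleftrightarrow> (\<exists>i j. k = i + j \<and> enat i \<le> x \<and> enat j \<le> y)"
proof
  assume le: "enat k \<le> x + y"
  show "\<exists>i j. k = i + j \<and> enat i \<le> x \<and> enat j \<le> y"
  proof (cases "enat k \<le> x")
    case True
    then show ?thesis by (intro exI[of _ k] exI[of _ 0]) (auto simp: zero_enat_def[symmetric])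
  next
    case False
    then obtain a where a: "x = enat a" "a < k" by (cases x) auto
    then show ?thesis using le
      by (intro exI[of _ a] exI[of _ "k - a"]) (cases y; auto)
  qed
next
  assume "\<exists>i j. k = i + j \<and> enat i \<le> x \<and> enat j \<le> y"
  then show "enat k \<le> x + y" by (metis add_mono plus_enat_simps(1))
qed

section \<open>Chains of ideals and the length of a subquotient\<close>

context cring
begin

text \<open>The base case admits \<open>A \<subset> B\<close>: \<open>chain_ge A B k\<close> says that some chain has length at least \<open>k\<close>.\<close>

inductive chain_ge :: "'a set \<Rightarrow> 'a set \<Rightarrow> nat \<Rightarrow> bool" where
  base: "ideal A R \<Longrightarrow> ideal B R \<Longrightarrow> A \<subseteq> B \<Longrightarrow> chain_ge A B 0"
| step: "chain_ge A B k \<Longrightarrow> ideal C R \<Longrightarrow> B \<subset> C \<Longrightarrow> chain_ge A C (Suc k)"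

lemma chain_geD:
  "chain_ge A B k \<Longrightarrow> ideal A R \<and> ideal B R \<and> A \<subseteq> B"
  by (induct rule: chain_ge.induct) auto

lemma chain_ge_extend:
  assumes "chain_ge A B k" "ideal C R" "B \<subseteq> C"
  shows "chain_ge A C k"
  using assms
proof (induct rule: chain_ge.induct)
  case (base A B)
  then show ?case by (blast intro: chain_ge.base)
next
  case (step A B k B')
  then show ?case by (meson chain_ge.step psubset_subset_trans)
qed

lemma chain_ge_trans:
  "chain_ge B C j \<Longrightarrow> chain_ge A B i \<Longrightarrow> chain_ge A C (i + j)"
  by (induct rule: chain_ge.induct) (auto intro: chain_ge_extend chain_ge.step)

lemma chain_ge_Suc_D: "chain_ge A B (Suc k) \<Longrightarrow> chain_ge A B k"
  by (erule chain_ge.cases) (auto intro: chain_ge_extend)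

lemma chain_ge_mono: "chain_ge A B k \<Longrightarrow> j \<le> k \<Longrightarrow> chain_ge A B j"
  by (induct k) (auto simp: le_Suc_eq dest: chain_ge_Suc_D)

lemma chain_ge_iff_chain:
  "chain_ge A B k \<longleftrightarrow> (\<exists>n\<ge>k. \<exists>C :: nat \<Rightarrow> 'a set.
      (\<forall>i\<le>n. ideal (C i) R) \<and> C 0 = A \<and> C n = B \<and> (\<forall>i<n. C i \<subset> C (Suc i)))"
    (is "_ \<longleftrightarrow> (\<exists>n\<ge>k. \<exists>C. ?ch C n B)")
proof
  assume "chain_ge A B k"
  then show "\<exists>n\<ge>k. \<exists>C. ?ch C n B"
  proof (induct rule: chain_ge.induct)
    case (base A B)
    show ?case
    proof (cases "A = B")
      case True
      then show ?thesis using base by (intro exI[of _ 0] conjI exI[of _ "\<lambda>_. A"]) auto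
    next
      case False
      then show ?thesis using base
        by (intro exI[of _ 1] conjI exI[of _ "\<lambda>i. if i = 0 then A else B"]) auto
    qed
  next
    case (step A B k C)
    then obtain n D where "n \<ge> k" "\<forall>i\<le>n. ideal (D i) R" "D 0 = A" "D n = B"
      "\<forall>i<n. D i \<subset> D (Suc i)" by blast
    then show ?case using step
      by (intro exI[of _ "Suc n"] conjI exI[of _ "D(Suc n := C)"]) (auto simp: less_Suc_eq)
  qed
next
  assume "\<exists>n\<ge>k. \<exists>C. ?ch C n B"
  then obtain n C where n: "n \<ge> k" "?ch C n B" by blast
  have "chain_ge A (C i) i" if "i \<le> n" for i
    using that
  proof (induct i)
    case 0
    then show ?case using n by (auto intro: chain_ge.base)
  next
    case (Suc i)
    then show ?case using n by (intro chain_ge.step[of A "C i"]) auto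
  qed
  then show "chain_ge A B k" using n chain_ge_mono by blast
qed

text \<open>Write an element of \<open>C\<close> as a + b with a in \<open>A\<close> and b in
  \<open>B\<close>; then a = c - b lies in \<open>A \<inter> C = A \<inter> B\<close>. Consequently
  a strict inclusion stays strict after intersection with a fixed ideal or after its addition, at
  least in one of the two.\<close>

lemma modular_eq:
  assumes "ideal A R" "ideal B R" "ideal C R" "B \<subseteq> C" "A \<inter> B = A \<inter> C" "A <+> B = A <+> C"
  shows "B = C"
proof
  show "C \<subseteq> B"
  proof
    fix c assume c: "c \<in> C"
    then have "c \<in> A <+> B" using set_add_upper[OF assms(1,3)] assms(6) by auto
    then obtain a b where ab: "a \<in> A" "b \<in> B" "c = a \<oplus> b" by (auto simp: set_add_iff)
    interpret A: ideal A R by fact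
    interpret B: ideal B R by fact
    interpret C: ideal C R by fact
    have carr: "a \<in> carrier R" "b \<in> carrier R" using ab A.Icarr B.Icarr by auto
    have "a = c \<ominus> b" using ab carr by (simp add: minus_eq a_assoc r_neg)
    moreover have "c \<ominus> b \<in> C"
      using c ab assms(4) by (auto simp: minus_eq intro!: C.a_closed C.a_inv_closed)
    ultimately have "a \<in> B" using ab assms(5) by blast
    then show "c \<in> B" using ab by simp
  qed
qed fact

text \<open>Intersect every member of the chain with \<open>B\<close>, and add \<open>B\<close> to
  every member. By \<open>modular_eq\<close> each strict step survives on one side at least, where
  it is counted; on the other side the chain is merely extended.\<close>

lemma chain_ge_split_aux:
  assumes "chain_ge A C k" "ideal B R" "A \<subseteq> B"
  shows "\<exists>i j. k = i + j \<and> chain_ge A (B \<inter> C) i \<and> chain_ge B (B <+> C) j"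
  using assms
proof (induct rule: chain_ge.induct)
  case (base A C)
  then show ?case
    using set_add_upper(1)[of B C]
    by (intro exI[of _ 0] conjI chain_ge.base i_intersect add_ideals) auto
next
  case (step A C k D)
  then obtain i j where ij: "k = i + j" "chain_ge A (B \<inter> C) i" "chain_ge B (B <+> C) j" by blast
  have id: "ideal C R" "ideal D R" using chain_geD[OF step.hyps(1)] step.hyps by simp_all
  have CD: "C \<subseteq> D" "C \<noteq> D" using \<open>C \<subset> D\<close> by simp_all
  then have sub: "B \<inter> C \<subseteq> B \<inter> D" "B <+> C \<subseteq> B <+> D"
    by (blast, intro set_add_mono) simp_all
  have "B \<inter> C \<noteq> B \<inter> D \<or> B <+> C \<noteq> B <+> D"
    using modular_eq[OF \<open>ideal B R\<close> id] CD by blast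
  then show ?case
  proof
    assume "B \<inter> C \<noteq> B \<inter> D"
    then have "chain_ge A (B \<inter> D) (Suc i)" 
      using sub ij \<open>ideal B R\<close> id by (intro chain_ge.step[of A "B \<inter> C"] i_intersect) blast+
    moreover have "chain_ge B (B <+> D) j"
      by (rule chain_ge_extend[OF ij(3) add_ideals[OF \<open>ideal B R\<close> id(2)] sub(2)])
    ultimately show ?thesis using ij(1) by (intro exI[of _ "Suc i"] exI[of _ j]) auto
  next
    assume "B <+> C \<noteq> B <+> D"
    then have "chain_ge B (B <+> D) (Suc j)" 
      using sub ij \<open>ideal B R\<close> id by (intro chain_ge.step[of B "B <+> C"] add_ideals) blast+
    moreover have "chain_ge A (B \<inter> D) i"
      by (rule chain_ge_extend[OF ij(2) i_intersect[OF \<open>ideal B R\<close> id(2)] sub(1)])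
    ultimately show ?thesis using ij(1) by (intro exI[of _ i] exI[of _ "Suc j"]) auto
  qed
qed

lemma chain_ge_split:
  assumes "ideal B R" "A \<subseteq> B" "B \<subseteq> C"
  shows "chain_ge A C k \<longleftrightarrow> (\<exists>i j. k = i + j \<and> chain_ge A B i \<and> chain_ge B C j)"
proof
  assume *: "chain_ge A C k"
  have "B \<inter> C = B" using assms by auto
  moreover have "B <+> C = C"
    using set_add_absorb(1)[OF assms(1) _ assms(3)] chain_geD[OF *] by auto
  ultimately show "\<exists>i j. k = i + j \<and> chain_ge A B i \<and> chain_ge B C j"
    using chain_ge_split_aux[OF * assms(1,2)] by auto
qed (auto intro: chain_ge_trans)

text \<open>The length of the module B / A, taken through the ideals between \<open>A\<close> and
  \<open>B\<close> so that no quotient is formed. It may be infinite, hence cancellation below asks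
  for finiteness.\<close>

definition len :: "'a set \<Rightarrow> 'a set \<Rightarrow> enat" where
  "len A B = Sup {enat k | k. chain_ge A B k}"

text \<open>A supremum of natural numbers that reaches a finite \<open>k\<close> has a member that
  is at least \<open>k\<close>, and \<open>chain_ge\<close> is closed downwards by
  \<open>chain_ge_mono\<close>.\<close>

lemma len_ge_iff:
  assumes "ideal A R" "ideal B R" "A \<subseteq> B"
  shows "enat k \<le> len A B \<longleftrightarrow> chain_ge A B k"
proof
  assume le: "enat k \<le> len A B"
  show "chain_ge A B k"
  proof (rule ccontr)
    assume n: "\<not> chain_ge A B k"
    then have k: "k \<noteq> 0" using chain_ge.base[OF assms] by (cases k) auto
    have "len A B \<le> enat (k - 1)"
      unfolding len_def
    proof (rule Sup_least)
      fix x assume "x \<in> {enat k | k. chain_ge A B k}"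
      then obtain j where j: "x = enat j" "chain_ge A B j" by auto
      then have "j < k" using n chain_ge_mono not_less by blast
      then show "x \<le> enat (k - 1)" using j by simp
    qed
    then have "enat k \<le> enat (k - 1)" using le by (rule order_trans[rotated])
    then show False using k by simp
  qed
next
  assume "chain_ge A B k"
  then show "enat k \<le> len A B" unfolding len_def by (intro Sup_upper) auto
qed

lemma len_add:
  assumes "ideal A R" "ideal B R" "ideal C R" "A \<subseteq> B" "B \<subseteq> C"
  shows "len A C = len A B + len B C"
proof (rule enat_eqI)
  fix k
  show "enat k \<le> len A C \<longleftrightarrow> enat k \<le> len A B + len B C"
    using assms chain_ge_split[of B A C k]
    by (auto simp: enat_le_add_iff len_ge_iff order_trans[of A B C])
qed

lemma len_mono:
  assumes "ideal A R" "ideal A' R" "ideal B R" "A \<subseteq> A'" "A' \<subseteq> B"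
  shows "len A' B \<le> len A B"
  using len_add[of A A' B] assms by simp

lemma quot_length_eq_len: 
  assumes "ideal J R"
  shows "quot_length R J = len J (carrier R)"
proof (rule order_antisym)
  show "quot_length R J \<le> len J (carrier R)"
    unfolding quot_length_def len_def
    by (rule Sup_subset_mono) (auto simp: chain_ge_iff_chain)
  show "len J (carrier R) \<le> quot_length R J"
    unfolding quot_length_def len_def
  proof (rule Sup_mono)
    fix a assume "a \<in> {enat k | k. chain_ge J (carrier R) k}"
    then obtain k n C where "a = enat k" "n \<ge> k" 
      "(\<forall>i\<le>n. ideal (C i) R) \<and> C 0 = J \<and> C n = carrier R \<and> (\<forall>i<n. C i \<subset> C (Suc i))"
      unfolding chain_ge_iff_chain by blast
    then show "\<exists>b\<in>{enat n | n. \<exists>C. (\<forall>i\<le>n. ideal (C i) R) \<and> C 0 = J \<and>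
        C n = carrier R \<and> (\<forall>i<n. C i \<subset> C (Suc i))}. a \<le> b"
      by (intro bexI[of _ "enat n"]) auto
  qed
qed

lemma len_pos:
  assumes "ideal A R" "ideal B R" "A \<subset> B"
  shows "1 \<le> len A B"
proof -
  have "chain_ge A B (Suc 0)"
    using assms by (intro chain_ge.step[of A A]) (auto intro: chain_ge.base)
  then show ?thesis
    using assms len_ge_iff[of A B "Suc 0"] by (auto simp: one_enat_def)
qed

lemma len_zero_iff:
  assumes "ideal A R" "ideal B R" "A \<subseteq> B"
  shows "len A B < 1 \<longleftrightarrow> A = B"
proof
  assume "len A B < 1" then show "A = B" using len_pos[OF assms(1,2)] assms(3) by fastforce
next
  assume "A = B"
  have False if "chain_ge B B 1"
  proof -
    from that obtain C k where "chain_ge B C k" "C \<subset> B"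
      by (cases rule: chain_ge.cases) auto
    then show False using chain_geD by blast
  qed
  then show "len A B < 1"
    using len_ge_iff[OF assms, of 1] \<open>A = B\<close> by (auto simp: one_enat_def not_le)
qed

lemma len_self: "ideal A R \<Longrightarrow> len A A = 0"
  using len_zero_iff[of A A] by (simp add: one_eSuc)

lemma len_1_cases:
  assumes "ideal A R" "ideal B R" "ideal C R" "A \<subseteq> B" "B \<subseteq> C" "len A C \<le> 1"
  shows "B = A \<or> B = C"
proof (rule ccontr)
  assume "\<not> ?thesis"
  then have "1 \<le> len A B" "1 \<le> len B C" using len_pos assms by blast+
  then have "1 + 1 \<le> len A B + len B C" by (rule add_mono)
  then have "1 + 1 \<le> (1 :: enat)"
    using len_add[OF assms(1-5)] assms(6) order_trans by metis
  then show False by (simp add: one_enat_def plus_enat_simps del: one_add_one)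
qed

text \<open>Multiplication by \<open>y\<close> identifies the ideals between \<open>(N : y) \<inter> B\<close> and \<open>B\<close> with those
  between \<open>N\<close> and \<open>N + y B\<close>.\<close>

lemma colon_ideal_in:
  assumes "ideal N R" "ideal B R" "y \<in> carrier R"
  shows "ideal {b \<in> B. y \<otimes> b \<in> N} R"
proof -
  have "{b \<in> B. y \<otimes> b \<in> N} = B \<inter> {a \<in> carrier R. a \<otimes> y \<in> N}"
    using assms ideal.Icarr[OF assms(2)] by (auto simp: m_comm)
  then show ?thesis using colon_ideal[OF assms(1,3)] i_intersect[OF assms(2)] by simp
qed

text \<open>Strictness is preserved: if \<open>d\<close> in the larger ideal had y d = n + y c with
  \<open>c\<close> in the smaller one, then d - c would lie in the colon \<open>A\<close>, which the
  smaller ideal contains.\<close>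

lemma chain_ge_push:
  assumes "chain_ge A C k" "A = {b \<in> B. y \<otimes> b \<in> N}" "C \<subseteq> B" 
    "ideal N R" "ideal B R" "y \<in> carrier R"
  shows "chain_ge N (N <+> (\<lambda>b. y \<otimes> b) ` C) k"
  using assms
proof (induct rule: chain_ge.induct)
  case (base A C)
  then show ?case
    by (intro chain_ge.base add_ideals dilate_ideal set_add_upper) auto
next
  case (step A C k D)
  interpret N: ideal N R by fact
  interpret D: ideal D R by fact
  interpret C: ideal C R using step chain_geD by blast
  let ?f = "\<lambda>C. N <+> (\<lambda>b. y \<otimes> b) ` C"
  have AC: "A \<subseteq> C" using step chain_geD by blast
  have "?f C \<subseteq> ?f D" using step by (intro set_add_mono) auto
  moreover have "?f C \<noteq> ?f D"
  proof
    assume eq: "?f C = ?f D"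
    obtain d where d: "d \<in> D" "d \<notin> C" using \<open>C \<subset> D\<close> by blast
    then have "y \<otimes> d \<in> ?f D"
      using set_add_upper(2)[of N "(\<lambda>b. y \<otimes> b) ` D"] dilate_ideal N.is_ideal D.is_ideal step
      by blast
    then obtain n c where nc: "n \<in> N" "c \<in> C" "y \<otimes> d = n \<oplus> y \<otimes> c"
      unfolding eq[symmetric] by (auto simp: set_add_iff)
    have carr: "n \<in> carrier R" "c \<in> carrier R" "d \<in> carrier R"
      using nc d N.Icarr C.Icarr D.Icarr by auto
    have "y \<otimes> (d \<ominus> c) = y \<otimes> d \<ominus> y \<otimes> c"
      using carr step by (simp add: minus_eq r_distr r_minus)
    also have "\<dots> = n" using nc carr step by (simp add: minus_eq a_assoc r_neg)
    finally have "y \<otimes> (d \<ominus> c) \<in> N" using nc by simp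
    moreover have "d \<ominus> c \<in> D"
      using d nc step by (auto simp: minus_eq intro!: D.a_closed D.a_inv_closed)
    ultimately have "d \<ominus> c \<in> C" using AC step by auto
    then have "d \<ominus> c \<oplus> c \<in> C" using nc C.a_closed by blast
    moreover have "d \<ominus> c \<oplus> c = d" using carr by (simp add: minus_eq a_assoc l_neg)
    ultimately show False using d by simp
  qed
  ultimately show ?case
    using step by (intro chain_ge.step[of N "?f C"] add_ideals dilate_ideal) auto
qed

text \<open>A new element of the larger ideal is n + y b with n in \<open>N\<close> and b in
  \<open>B\<close>; this b separates the two preimages.\<close>

lemma chain_ge_pull:
  assumes "chain_ge N C k" "C \<subseteq> N <+> (\<lambda>b. y \<otimes> b) ` B" "ideal B R" "y \<in> carrier R"
  shows "chain_ge {b \<in> B. y \<otimes> b \<in> N} {b \<in> B. y \<otimes> b \<in> C} k"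
  using assms
proof (induct rule: chain_ge.induct)
  case (base N C)
  then show ?case by (intro chain_ge.base colon_ideal_in) auto
next
  case (step N C k D)
  interpret D: ideal D R by fact
  interpret B: ideal B R by fact
  have C: "ideal C R" "N \<subseteq> C" "ideal N R" using step chain_geD by auto
  interpret C: ideal C R by (rule C)
  obtain d where d: "d \<in> D" "d \<notin> C" using \<open>C \<subset> D\<close> by blast
  then have "d \<in> N <+> (\<lambda>b. y \<otimes> b) ` B" using step.prems(1) by blast
  then obtain n b where nb: "n \<in> N" "b \<in> B" "d = n \<oplus> y \<otimes> b"
    unfolding set_add_iff by blast
  have carr: "n \<in> carrier R" "y \<otimes> b \<in> carrier R" "d \<in> carrier R"
    using ideal.Icarr[OF C(3) nb(1)] B.Icarr[OF nb(2)] D.Icarr[OF d(1)] step.prems by simp_all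
  have "y \<otimes> b = d \<ominus> n" using nb carr by (simp add: minus_eq a_ac r_neg2)
  moreover have "d \<ominus> n \<in> D"
    using d nb step C by (auto simp: minus_eq intro!: D.a_closed D.a_inv_closed)
  ultimately have "b \<in> {b \<in> B. y \<otimes> b \<in> D}" using nb by auto
  moreover have "b \<notin> {b \<in> B. y \<otimes> b \<in> C}"
    using nb d C C.a_closed by auto
  ultimately show ?case
    using step C
    by (intro chain_ge.step[of _ "{b \<in> B. y \<otimes> b \<in> C}"] colon_ideal_in) auto
qed

lemma len_dilate:
  assumes "ideal N R" "ideal B R" "y \<in> carrier R"
  shows "len N (N <+> (\<lambda>b. y \<otimes> b) ` B) = len {b \<in> B. y \<otimes> b \<in> N} B"
proof (rule enat_eqI)
  fix k
  let ?S = "N <+> (\<lambda>b. y \<otimes> b) ` B"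
  have id: "ideal ?S R" "N \<subseteq> ?S" "ideal {b \<in> B. y \<otimes> b \<in> N} R"
    by (intro add_ideals dilate_ideal set_add_upper colon_ideal_in assms)+
  have "{b \<in> B. y \<otimes> b \<in> ?S} = B"
    using set_add_upper(2)[OF assms(1) dilate_ideal[OF assms(3,2)]] by auto
  then have "chain_ge N ?S k \<longleftrightarrow> chain_ge {b \<in> B. y \<otimes> b \<in> N} B k"
    using chain_ge_pull[of N ?S k y B] chain_ge_push[of _ B k B y N] assms by auto
  then show "enat k \<le> len N ?S \<longleftrightarrow> enat k \<le> len {b \<in> B. y \<otimes> b \<in> N} B"
    using len_ge_iff[of N ?S k] len_ge_iff[of "{b \<in> B. y \<otimes> b \<in> N}" B k] id assms by auto
qed

end

section \<open>Noetherian local rings\<close>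

context cring
begin

lemma dilate_eq_prod:
  assumes "x \<in> carrier R" "ideal B R"
  shows "(\<lambda>b. x \<otimes> b) ` B = (\<lambda>b. x \<otimes> b) ` carrier R \<cdot> B"
proof
  have idR: "ideal ((\<lambda>b. x \<otimes> b) ` carrier R) R"
    by (rule dilate_ideal[OF assms(1) oneideal])
  show "(\<lambda>b. x \<otimes> b) ` B \<subseteq> (\<lambda>b. x \<otimes> b) ` carrier R \<cdot> B"
  proof
    fix a assume "a \<in> (\<lambda>b. x \<otimes> b) ` B"
    then obtain b where "b \<in> B" "a = x \<otimes> b" by blast
    moreover have "x \<in> (\<lambda>b. x \<otimes> b) ` carrier R"
      by (rule image_eqI[of _ _ "\<one>"]) (simp_all add: assms(1))
    ultimately show "a \<in> (\<lambda>b. x \<otimes> b) ` carrier R \<cdot> B"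
      using ideal_prod.prod[of x _ b B R] by simp
  qed
  show "(\<lambda>b. x \<otimes> b) ` carrier R \<cdot> B \<subseteq> (\<lambda>b. x \<otimes> b) ` B"
  proof (rule ideal_prod_least[OF dilate_ideal[OF assms]])
    fix a b assume "a \<in> (\<lambda>b. x \<otimes> b) ` carrier R" and b: "b \<in> B"
    then obtain r where r: "r \<in> carrier R" "a = x \<otimes> r" by blast
    then have "a \<otimes> b = x \<otimes> (r \<otimes> b)"
      using assms(1) ideal.Icarr[OF assms(2) b] by (simp add: m_assoc)
    then show "a \<otimes> b \<in> (\<lambda>b. x \<otimes> b) ` B"
      using ideal.I_l_closed[OF assms(2) b r(1)] by blast
  qed
qed

text \<open>Products of degree i + 1 either take all their factors from \<open>A\<close> or have a
  factor from \<open>P\<close>. With \<open>P\<close> principal this separates the monomials by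
  divisibility by the last generator.\<close>

lemma power_sum_Suc:
  assumes A: "ideal A R" and P: "ideal P R"
  shows "ideal_pow R (A <+> P) (Suc i) = ideal_pow R A (Suc i) <+> P \<cdot> ideal_pow R (A <+> P) i"
proof -
  let ?S = "A <+> P"
  have S: "ideal ?S R" by (rule add_ideals[OF assms])
  note pw = ideal_pow_ideal[OF S] ideal_pow_ideal[OF A]
  have main: "A \<cdot> ideal_pow R ?S i \<subseteq> ideal_pow R A (Suc i) <+> P \<cdot> ideal_pow R ?S i" for i
  proof (induct i)
    case 0
    have "A \<cdot> carrier R \<subseteq> A \<cdot> carrier R <+> P \<cdot> carrier R"
      by (intro set_add_upper ideal_prod_is_ideal oneideal assms)
    then show ?case by simp
  next
    case (Suc i)
    let ?T = "ideal_pow R A (Suc (Suc i)) <+> P \<cdot> ideal_pow R ?S (Suc i)"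
    have T: "ideal ?T R" by (intro add_ideals ideal_prod_is_ideal pw P)
    have "ideal_pow R ?S (Suc i) = A \<cdot> ideal_pow R ?S i <+> P \<cdot> ideal_pow R ?S i"
      using ideal_prod_distr(2)[OF pw(1) A P] by simp
    also have "\<dots> \<subseteq> ideal_pow R A (Suc i) <+> P \<cdot> ideal_pow R ?S i"
      using set_add_upper[OF pw(2)[of "Suc i"] ideal_prod_is_ideal[OF P pw(1)[of i]]]
      by (intro set_add_least[OF add_ideals[OF pw(2) ideal_prod_is_ideal[OF P pw(1)]]] Suc)
    finally have "A \<cdot> ideal_pow R ?S (Suc i)
        \<subseteq> A \<cdot> (ideal_pow R A (Suc i) <+> P \<cdot> ideal_pow R ?S i)"
      by (rule ideal_prod_mono[OF subset_refl])
    also have "\<dots> = A \<cdot> ideal_pow R A (Suc i) <+> A \<cdot> (P \<cdot> ideal_pow R ?S i)"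
      by (rule ideal_prod_distr(1)[OF A pw(2) ideal_prod_is_ideal[OF P pw(1)]])
    also have "A \<cdot> (P \<cdot> ideal_pow R ?S i) = P \<cdot> (A \<cdot> ideal_pow R ?S i)"
      by (rule ideal_prod_left_commute[OF A P pw(1)])
    also have "A \<cdot> ideal_pow R A (Suc i) <+> P \<cdot> (A \<cdot> ideal_pow R ?S i) \<subseteq> ?T"
      unfolding ideal_pow.simps(2)[of R A "Suc i"] ideal_pow.simps(2)[of R ?S i]
      by (intro set_add_mono ideal_prod_mono subset_refl set_add_upper A P)
    finally show ?case .
  qed
  show ?thesis
  proof
    have "ideal_pow R ?S (Suc i) = A \<cdot> ideal_pow R ?S i <+> P \<cdot> ideal_pow R ?S i"
      using ideal_prod_distr(2)[OF pw(1) A P] by simp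
    also have "\<dots> \<subseteq> ideal_pow R A (Suc i) <+> P \<cdot> ideal_pow R ?S i"
      using set_add_upper[OF pw(2)[of "Suc i"] ideal_prod_is_ideal[OF P pw(1)[of i]]]
      by (intro set_add_least[OF add_ideals[OF pw(2) ideal_prod_is_ideal[OF P pw(1)]]] main)
    finally show "ideal_pow R ?S (Suc i) \<subseteq> ideal_pow R A (Suc i) <+> P \<cdot> ideal_pow R ?S i" .
    have "ideal_pow R A (Suc i) \<subseteq> ideal_pow R ?S (Suc i)"
      by (intro ideal_pow_mono set_add_upper assms)
    moreover have "P \<cdot> ideal_pow R ?S i \<subseteq> ideal_pow R ?S (Suc i)"
      unfolding ideal_pow.simps by (intro ideal_prod_mono set_add_upper assms subset_refl)
    ultimately show "ideal_pow R A (Suc i) <+> P \<cdot> ideal_pow R ?S i \<subseteq> ideal_pow R ?S (Suc i)"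
      by (rule set_add_least[OF pw(1)])
  qed
qed

text \<open>The power is spanned by \<open>i + p - 1 choose i\<close> monomials, and each
  contributes a cyclic module killed by \<open>c\<close>, hence of length at most that of R / c.
  Pascal's rule separates the monomials without the last element from those divisible by it.
  \<open>A\<close> is arbitrary so that the induction hypothesis can be applied to a colon
  ideal.\<close>

lemma len_add_power:
  assumes c: "ideal c R" and "ideal A R" "\<forall>i<p. x i \<in> carrier R"
    and "c \<cdot> ideal_pow R (gen_by R x p) i \<subseteq> A"
  shows "len A (A <+> ideal_pow R (gen_by R x p) i) \<le> enat (i + p - 1 choose i) * len c (carrier R)"
  using assms(2-)
proof (induct "i + p" arbitrary: i p A rule: less_induct)
  case less
  have xc: "j < p \<Longrightarrow> x j \<in> carrier R" for j using less.prems(2) by blast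
  have gi: "ideal (gen_by R x p) R" by (rule span_by_ideal[OF xc oneideal])
  show ?case
  proof (cases i)
    case 0
    have "c \<subseteq> A" using less.prems 0 by (simp add: ideal_prod_one c)
    moreover have "A <+> carrier R = carrier R"
      using set_add_absorb(1)[OF less.prems(1) oneideal ideal_subset_carrier[OF less.prems(1)]] .
    ultimately show ?thesis
      using len_mono[OF c less.prems(1) oneideal] ideal_subset_carrier[OF less.prems(1)] 0
      by (simp add: one_enat_def[symmetric, simplified])
  next
    case (Suc i')
    show ?thesis
    proof (cases p)
      case 0
      have "ideal_pow R {\<zero>} i = {\<zero>}"
        using ideal_prod_zero[OF ideal_pow_ideal[OF zeroideal, of i']] Suc
          ideal_prod_commute[OF ideal_pow_ideal[OF zeroideal, of i'] zeroideal] by simp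
      then have "A <+> ideal_pow R (gen_by R x p) i = A"
        using set_add_absorb(2)[OF zeroideal less.prems(1)] 0
          additive_subgroup.zero_closed[OF ideal.axioms(1)[OF less.prems(1)]] by simp
      then show ?thesis using len_self[OF less.prems(1)] by simp
    next
      case (Suc p')
      note p = Suc and i = \<open>i = Suc i'\<close>
      define L where "L = gen_by R x p"
      define L' where "L' = gen_by R x p'"
      have xp: "x p' \<in> carrier R" using xc p by simp
      have xc': "\<forall>j<p'. x j \<in> carrier R" using xc p by simp
      have idL: "ideal L R" unfolding L_def by (rule gi)
      have idL': "ideal L' R" unfolding L'_def by (rule span_by_ideal[OF _ oneideal]) (use xc' in blast)
      let ?B = "ideal_pow R L i'"
      note pw = ideal_pow_ideal[OF idL] ideal_pow_ideal[OF idL']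
      have L: "L = L' <+> (\<lambda>b. x p' \<otimes> b) ` carrier R" unfolding L_def L'_def p by simp
      have Li: "ideal_pow R L i = ideal_pow R L' i <+> (\<lambda>b. x p' \<otimes> b) ` ?B"
        using power_sum_Suc[OF idL' dilate_ideal[OF xp oneideal], of i']
        unfolding L[symmetric] i dilate_eq_prod[OF xp pw(1)] .
      have LL: "L' \<subseteq> L"
        unfolding L by (intro set_add_upper idL' dilate_ideal xp oneideal)
      define A' where "A' = A <+> ideal_pow R L' i"
      have idA': "ideal A' R" unfolding A'_def by (intro add_ideals less.prems pw)
      have A': "A \<subseteq> A'" unfolding A'_def by (intro set_add_upper less.prems pw)
      have cL: "c \<cdot> ideal_pow R L i \<subseteq> A" using less.prems(3) unfolding L_def .
      have top: "A <+> ideal_pow R L i = A' <+> (\<lambda>b. x p' \<otimes> b) ` ?B"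
        unfolding Li A'_def
        by (rule set_add_assoc[symmetric])
          (intro ideal_subset_carrier less.prems pw dilate_ideal xp)+
      have "c \<cdot> ideal_pow R L' i \<subseteq> A"
        using ideal_prod_mono[OF subset_refl ideal_pow_mono[OF LL]] cL by blast
      then have "len A A' \<le> enat (i + p' - 1 choose i) * len c (carrier R)"
        unfolding A'_def L'_def
        by (intro less.hyps) (use p i less.prems(1) xc' in auto)
      moreover have "len A' (A' <+> (\<lambda>b. x p' \<otimes> b) ` ?B)
          \<le> enat (i' + p - 1 choose i') * len c (carrier R)"
      proof -
        \<comment> \<open>The monomials divisible by \<open>x p'\<close> are \<open>x p'\<close>
          times those of degree \<open>i'\<close>. By \<open>len_dilate\<close> their contribution
          is the length of the lower power over this colon, which again contains \<open>c\<close>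
          times that power.\<close>
        let ?C = "{b \<in> ?B. x p' \<otimes> b \<in> A'}"
        have idC: "ideal ?C R" by (intro colon_ideal_in idA' pw xp)
        have "c \<cdot> ?B \<subseteq> ?C"
        proof (rule ideal_prod_least[OF idC])
          fix u b assume u: "u \<in> c" and b: "b \<in> ?B"
          have carr: "u \<in> carrier R" "b \<in> carrier R"
            using ideal.Icarr[OF c u] ideal.Icarr[OF pw(1) b] .
          have "x p' \<otimes> b \<in> ideal_pow R L i"
            unfolding Li
            by (rule subsetD[OF set_add_upper(2)[OF pw(2) dilate_ideal[OF xp pw(1)]]])
              (use b in blast)
          then have "u \<otimes> (x p' \<otimes> b) \<in> A"
            using cL ideal_prod.prod[OF u, of "x p' \<otimes> b" _ R] by blast
          then have "x p' \<otimes> (u \<otimes> b) \<in> A'"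
            using A' carr xp by (auto simp: m_lcomm)
          then show "u \<otimes> b \<in> ?C"
            using ideal.I_l_closed[OF pw(1) b carr(1)] by simp
        qed
        then have "len ?C (?C <+> ideal_pow R (gen_by R x p) i')
          \<le> enat (i' + p - 1 choose i') * len c (carrier R)"
          using less.prems(2) idC i L_def by (intro less.hyps) auto
        moreover have "?C <+> ?B = ?B"
          by (rule set_add_absorb(1)[OF idC pw(1)]) blast
        ultimately show ?thesis
          unfolding len_dilate[OF idA' pw(1) xp] by (simp add: L_def)
      qed
      moreover have "len A (A <+> ideal_pow R L i) = len A A' + len A' (A' <+> (\<lambda>b. x p' \<otimes> b) ` ?B)"
        unfolding top
        by (intro len_add less.prems idA' add_ideals dilate_ideal xp pw A' set_add_upper)
      ultimately have "len A (A <+> ideal_pow R L i)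
          \<le> enat (i + p' - 1 choose i) * len c (carrier R)
            + enat (i' + p - 1 choose i') * len c (carrier R)"
        by (simp add: add_mono)
      also have "\<dots> = enat ((i + p' - 1 choose i) + (i' + p - 1 choose i')) * len c (carrier R)"
        by (simp add: distrib_right flip: plus_enat_simps(1))
      also have "(i + p' - 1 choose i) + (i' + p - 1 choose i') = (i + p - 1 choose i)"
        using p i by simp
      finally show ?thesis unfolding L_def .
    qed
  qed
qed

text \<open>Generators are added one at a time; by \<open>power_sum_subset\<close> the exponents add
  up.\<close>

lemma gen_by_power_subset:
  assumes "ideal Q R" "\<forall>i<k. y i \<in> carrier R" "\<forall>i<k. \<exists>n::nat. y i [^] n \<in> Q"
  shows "\<exists>n. ideal_pow R (gen_by R y k) n \<subseteq> Q"
  using assms(2,3)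
proof (induct k)
  case 0
  have "ideal_pow R {\<zero>} (Suc 0) \<subseteq> Q"
    using ideal_pow_one[OF zeroideal] additive_subgroup.zero_closed[OF ideal.axioms(1)[OF assms(1)]]
    by simp
  then show ?case unfolding span_by.simps by blast
next
  case (Suc k)
  then obtain a where a: "ideal_pow R (gen_by R y k) a \<subseteq> Q" by auto
  obtain n :: nat where n: "y k [^] n \<in> Q" using Suc.prems by auto
  have yk: "y k \<in> carrier R" using Suc.prems by simp
  let ?P = "(\<lambda>b. y k \<otimes> b) ` carrier R"
  have P: "ideal ?P R" by (rule dilate_ideal[OF yk oneideal])
  have pow: "ideal_pow R ?P j \<subseteq> (\<lambda>b. y k [^] j \<otimes> b) ` carrier R" for j :: nat
  proof (induct j)
    case 0
    show ?case
    proof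
      fix a assume "a \<in> ideal_pow R ?P 0"
      then have "a \<in> carrier R" by simp
      then show "a \<in> (\<lambda>b. y k [^] (0::nat) \<otimes> b) ` carrier R"
        by (intro image_eqI[of _ _ a]) simp_all
    qed
  next
    case (Suc j)
    have "ideal_pow R ?P (Suc j) = (\<lambda>b. y k \<otimes> b) ` ideal_pow R ?P j"
      using dilate_eq_prod[OF yk ideal_pow_ideal[OF P]] by simp
    also have "\<dots> \<subseteq> (\<lambda>b. y k \<otimes> b) ` ((\<lambda>b. y k [^] j \<otimes> b) ` carrier R)"
      using Suc by (rule image_mono)
    also have "\<dots> \<subseteq> (\<lambda>b. y k [^] Suc j \<otimes> b) ` carrier R"
      unfolding image_image
    proof (rule equalityD1, rule image_cong[OF refl])
      fix b assume "b \<in> carrier R"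
      then show "y k \<otimes> (y k [^] j \<otimes> b) = y k [^] Suc j \<otimes> b"
        using yk by (simp add: m_assoc m_lcomm)
    qed
    finally show ?case .
  qed
  have "ideal_pow R ?P n \<subseteq> Q"
  proof (rule order_trans[OF pow[of n]], rule image_subsetI)
    fix b assume "b \<in> carrier R"
    then show "y k [^] n \<otimes> b \<in> Q" by (rule ideal.I_r_closed[OF assms(1) n])
  qed
  moreover have "ideal (gen_by R y k) R"
    by (rule span_by_ideal[OF _ oneideal]) (use Suc.prems in simp)
  ultimately have "ideal_pow R (gen_by R y (Suc k)) (a + n) \<subseteq> Q"
    unfolding span_by.simps by (intro power_sum_subset P assms a)
  then show ?case by blast
qed

end

section \<open>Nakayama's lemma and finite length over the local ring\<close>

locale noetherian_local_ring = noetherian_ring R + cring R for R (structure) +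
  fixes m
  assumes maximalideal_m: "maximalideal m R"
    and maximalideal_unique: "maximalideal M R \<Longrightarrow> M = m"
begin

lemma ideal_m: "ideal m R"
  using maximalideal_m by (rule maximalideal.axioms(1))

lemma m_proper: "m \<noteq> carrier R" "\<one> \<notin> m"
  using maximalideal.I_notcarr[OF maximalideal_m] ideal.one_imp_carrier[OF ideal_m] by auto

lemma primeideal_m: "primeideal m R"
  by (rule maximalideal_prime[OF maximalideal_m])

text \<open>Noetherian induction in the form of a maximal counterexample: a nonempty chain of ideals
  contains its own union, so Zorn's lemma applies.\<close>

lemma exists_maximal_ideal_in:
  assumes "S \<noteq> {}" "\<And>C. C \<in> S \<Longrightarrow> ideal C R"
  obtains M where "M \<in> S" "\<And>C. C \<in> S \<Longrightarrow> M \<subseteq> C \<Longrightarrow> C = M"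
proof -
  have "\<exists>M\<in>S. \<forall>X\<in>S. M \<subseteq> X \<longrightarrow> X = M"
  proof (rule subset_Zorn_nonempty[OF assms(1)])
    fix C assume C: "C \<noteq> {}" "subset.chain S C"
    then have "subset.chain {I. ideal I R} C"
      using assms(2) by (auto simp: subset_chain_def)
    then have "\<Union>C \<in> C" by (rule ideal_chain_is_trivial[OF C(1)])
    then show "\<Union>C \<in> S" using C(2) by (auto simp: subset_chain_def)
  qed
  then show ?thesis using that by metis
qed

lemma proper_subset_m:
  assumes "ideal A R" "A \<noteq> carrier R"
  shows "A \<subseteq> m"
proof -
  obtain M where M: "M \<in> {C. ideal C R \<and> C \<noteq> carrier R \<and> A \<subseteq> C}"
    and max: "\<And>C. C \<in> {C. ideal C R \<and> C \<noteq> carrier R \<and> A \<subseteq> C} \<Longrightarrow> M \<subseteq> C \<Longrightarrow> C = M"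
    by (rule exists_maximal_ideal_in[of "{C. ideal C R \<and> C \<noteq> carrier R \<and> A \<subseteq> C}"])
      (use assms in auto)
  have "maximalideal M R"
  proof (rule maximalidealI)
    fix C assume "ideal C R" "M \<subseteq> C" "C \<subseteq> carrier R"
    then show "C = M \<or> C = carrier R" using max[of C] M by blast
  qed (use M in auto)
  then show ?thesis using maximalideal_unique M by blast
qed

lemma unit_iff: "a \<in> carrier R \<Longrightarrow> a \<notin> m \<Longrightarrow> a \<in> Units R"
  using proper_subset_m[OF cgenideal_ideal[of a]] ideal_eq_carrier_iff[of a] cgenideal_self[of a]
  by blast

lemma unit_cancel:
  assumes "ideal C R" "u \<in> carrier R" "u \<notin> m" "b \<in> carrier R" "u \<otimes> b \<in> C"
  shows "b \<in> C"
proof -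
  have u: "u \<in> Units R" using unit_iff assms by blast
  have "inv u \<otimes> (u \<otimes> b) \<in> C" using ideal.I_l_closed[OF assms(1,5)] u by simp
  then show ?thesis using u assms by (simp add: m_assoc[symmetric])
qed

text \<open>Among the ideals that contain \<open>A\<close> but not \<open>M\<close>, choose a
  maximal one \<open>C\<close>, so that every strictly larger ideal contains \<open>M\<close>. Then
  \<open>m \<cdot> M \<subseteq> C\<close>, whence \<open>A <+> m \<cdot> M\<close>, and with it
  \<open>M\<close>, lies in \<open>C\<close>.\<close>

lemma nakayama:
  assumes "ideal M R" "ideal A R" "M \<subseteq> A <+> m \<cdot> M"
  shows "M \<subseteq> A"
proof (rule ccontr)
  assume nM: "\<not> M \<subseteq> A"
  obtain C where C: "C \<in> {C. ideal C R \<and> A \<subseteq> C \<and> \<not> M \<subseteq> C}"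
    and max: "\<And>D. D \<in> {C. ideal C R \<and> A \<subseteq> C \<and> \<not> M \<subseteq> C} \<Longrightarrow> C \<subseteq> D \<Longrightarrow> D = C"
    by (rule exists_maximal_ideal_in[of "{C. ideal C R \<and> A \<subseteq> C \<and> \<not> M \<subseteq> C}"])
      (use assms nM in auto)
  then have idC: "ideal C R" by blast
  interpret C: ideal C R by (rule idC)
  have grow: "M \<subseteq> C <+> (\<lambda>r. b \<otimes> r) ` carrier R" if b: "b \<in> carrier R" "b \<notin> C" for b
  proof (rule ccontr)
    let ?D = "C <+> (\<lambda>r. b \<otimes> r) ` carrier R"
    assume n: "\<not> M \<subseteq> ?D"
    have P: "ideal ((\<lambda>r. b \<otimes> r) ` carrier R) R" by (rule dilate_ideal[OF b(1) oneideal])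
    have "?D = C"
      by (rule max) (use n C add_ideals[OF idC P] set_add_upper(1)[OF idC P] in auto)
    moreover have "b \<in> (\<lambda>r. b \<otimes> r) ` carrier R"
      using b by (intro image_eqI[of _ _ "\<one>"]) simp_all
    ultimately show False using set_add_upper(2)[OF idC P] b by blast
  qed
  obtain b where b: "b \<in> M" "b \<notin> C" using C by blast
  have bc: "b \<in> carrier R" using ideal.Icarr[OF assms(1) b(1)] .
  \<comment> \<open>If u b were outside \<open>C\<close>, maximality would give b = c + u b r with c
    in \<open>C\<close>; then (1 - u r) b lies in \<open>C\<close>, and 1 - u r is a unit.\<close>
  have ub: "u \<otimes> b \<in> C" if u: "u \<in> m" for u
  proof (rule ccontr)
    assume n: "u \<otimes> b \<notin> C"
    have uc: "u \<in> carrier R" using ideal.Icarr[OF ideal_m u] .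
    have "b \<in> C <+> (\<lambda>r. (u \<otimes> b) \<otimes> r) ` carrier R"
      by (rule subsetD[OF grow[OF m_closed[OF uc bc] n] b(1)])
    then obtain c r where cr: "c \<in> C" "r \<in> carrier R" "b = c \<oplus> u \<otimes> b \<otimes> r"
      unfolding set_add_iff by blast
    have cc: "c \<in> carrier R" using C.Icarr[OF cr(1)] .
    have ur: "u \<otimes> r \<in> m" by (rule ideal.I_r_closed[OF ideal_m u cr(2)])
    have "\<one> \<ominus> u \<otimes> r \<notin> m"
    proof
      assume "\<one> \<ominus> u \<otimes> r \<in> m"
      then have "\<one> \<ominus> u \<otimes> r \<oplus> u \<otimes> r \<in> m"
        using additive_subgroup.a_closed[OF ideal.axioms(1)[OF ideal_m] _ ur] by blast
      moreover have "\<one> \<ominus> u \<otimes> r \<oplus> u \<otimes> r = \<one>"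
        using uc cr(2) by algebra
      ultimately show False using m_proper by simp
    qed
    moreover have "(\<one> \<ominus> u \<otimes> r) \<otimes> b = c"
    proof -
      have "(\<one> \<ominus> u \<otimes> r) \<otimes> b = b \<ominus> u \<otimes> b \<otimes> r" using uc cr(2) bc by algebra
      also have "\<dots> = c \<oplus> u \<otimes> b \<otimes> r \<ominus> u \<otimes> b \<otimes> r" using cr(3) by simp
      also have "\<dots> = c" using uc cr(2) bc cc by algebra
      finally show ?thesis .
    qed
    ultimately have "b \<in> C"
      using unit_cancel[OF idC _ _ bc, of "\<one> \<ominus> u \<otimes> r"] cr uc by simp
    then show False using b by blast
  qed
  \<comment> \<open>Maximality also puts \<open>M\<close> into C + b R, and \<open>m\<close> carries
    both summands into \<open>C\<close>.\<close>
  have "m \<cdot> M \<subseteq> C"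
  proof (rule ideal_prod_least[OF idC])
    fix u z assume u: "u \<in> m" and z: "z \<in> M"
    have uc: "u \<in> carrier R" using ideal.Icarr[OF ideal_m u] .
    obtain c r where cr: "c \<in> C" "r \<in> carrier R" "z = c \<oplus> b \<otimes> r"
      using subsetD[OF grow[OF bc b(2)] z] unfolding set_add_iff by blast
    have "u \<otimes> z = u \<otimes> c \<oplus> r \<otimes> (u \<otimes> b)"
      using cr uc bc C.Icarr[OF cr(1)] by (simp, algebra)
    then show "u \<otimes> z \<in> C"
      using C.a_closed[OF C.I_l_closed[OF cr(1) uc] C.I_l_closed[OF ub[OF u] cr(2)]] by simp
  qed
  then have "A <+> m \<cdot> M \<subseteq> C" using C by (intro set_add_least[OF idC]) auto
  then show False using assms(3) C by blast
qed

lemma ideal_gen_by: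
  assumes "ideal I R"
  obtains y k where "\<forall>i<k. y i \<in> I" "gen_by R y k = I"
proof -
  obtain Z where Z: "Z \<subseteq> carrier R" "finite Z" "I = Idl Z"
    using finetely_gen[OF assms] by blast
  obtain y and k :: nat where "\<forall>i<k. y i \<in> Z" "gen_by R y k = Idl Z"
    using gen_by_finite[OF Z(2,1)] by blast
  then show ?thesis using that[of k y] Z genideal_self[OF Z(1)] by blast
qed

lemma power_subset_of_radical:
  assumes "ideal A R" "ideal Q R" "\<forall>a\<in>A. \<exists>n::nat. a [^] n \<in> Q"
  shows "\<exists>n. ideal_pow R A n \<subseteq> Q"
proof -
  obtain y k where y: "\<forall>i<k. y i \<in> A" "gen_by R y k = A" using ideal_gen_by[OF assms(1)] .
  have "\<exists>n. ideal_pow R (gen_by R y k) n \<subseteq> Q"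
    by (rule gen_by_power_subset[OF assms(2)])
      (use y assms(3) ideal_subset_carrier[OF assms(1)] in blast)+
  then show ?thesis using y by simp
qed

lemma len_m: "len m (carrier R) = 1"
proof (rule order_antisym)
  show "1 \<le> len m (carrier R)"
    by (rule len_pos[OF ideal_m oneideal]) (use m_proper ideal_subset_carrier[OF ideal_m] in blast)
  have "\<not> chain_ge m (carrier R) 2"
  proof
    assume "chain_ge m (carrier R) 2"
    then have "chain_ge m (carrier R) (Suc (Suc 0))" by (simp add: numeral_2_eq_2)
    then obtain B where B: "chain_ge m B (Suc 0)" "B \<subset> carrier R"
      by (cases rule: chain_ge.cases) auto
    then obtain D where D: "chain_ge m D 0" "D \<subset> B"
      by (cases rule: chain_ge.cases) auto
    show False
      using B D chain_geD[OF B(1)] chain_geD[OF D(1)] proper_subset_m[of B] by blast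
  qed
  then have "\<not> enat 2 \<le> len m (carrier R)"
    using len_ge_iff[OF ideal_m oneideal ideal_subset_carrier[OF ideal_m]] by blast
  then show "len m (carrier R) \<le> 1" by (cases "len m (carrier R)") (auto simp: one_enat_def)
qed

text \<open>Each layer m^k / m^(k+1) is killed by \<open>m\<close> and finitely generated, so
  \<open>len_add_power\<close> with annihilator \<open>m\<close> bounds its length.\<close>

lemma len_finite:
  assumes "ideal J R" "ideal_pow R m k \<subseteq> J"
  shows "len J (carrier R) < \<infinity>"
proof -
  obtain y p where y: "\<forall>i<p. y i \<in> m" "gen_by R y p = m" using ideal_gen_by[OF ideal_m] .
  have yc: "\<forall>i<p. y i \<in> carrier R" using y ideal_subset_carrier[OF ideal_m] by blast
  have fin: "len (ideal_pow R m k) (carrier R) < \<infinity>" for k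
  proof (induct k)
    case 0
    then show ?case using len_self[OF oneideal] by simp
  next
    case (Suc k)
    note pw = ideal_pow_ideal[OF ideal_m]
    let ?A = "ideal_pow R m (Suc k)"
    have sub: "?A \<subseteq> ideal_pow R m k" by (rule ideal_pow_antimono[OF ideal_m]) simp
    have "len ?A (?A <+> ideal_pow R (gen_by R y p) k)
        \<le> enat (k + p - 1 choose k) * len m (carrier R)"
      by (rule len_add_power[OF ideal_m pw yc]) (simp add: y)
    then have "len ?A (ideal_pow R m k) < \<infinity>"
      using set_add_absorb(1)[OF pw pw sub] y(2) len_m
      by (cases "len ?A (ideal_pow R m k)") auto
    then show ?case
      using len_add[OF pw pw oneideal sub ideal_subset_carrier[OF pw]] Suc
      by (cases "len ?A (ideal_pow R m k)"; cases "len (ideal_pow R m k) (carrier R)") auto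
  qed
  show ?thesis
    by (rule le_less_trans[OF len_mono[OF ideal_pow_ideal[OF ideal_m] assms(1) oneideal assms(2)
        ideal_subset_carrier[OF assms(1)]] fin])
qed

end

section \<open>Generic elements\<close>

context noetherian_local_ring
begin

text \<open>The image of \<open>B\<close> in the residue field is finite. The representatives in
  \<open>F\<close> may lie outside \<open>B\<close>, so that subsets inherit the property at
  once.\<close>

definition finite_mod :: "'a set \<Rightarrow> bool" where
  "finite_mod B \<longleftrightarrow> (\<exists>F. finite F \<and> F \<subseteq> carrier R \<and> (\<forall>t\<in>B. \<exists>u\<in>F. t \<ominus> u \<in> m))"

lemma finite_mod_subset: "finite_mod B \<Longrightarrow> A \<subseteq> B \<Longrightarrow> finite_mod A"
  unfolding finite_mod_def by blast

lemma finite_mod_Un: 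
  assumes "finite_mod A" "finite_mod B" 
  shows "finite_mod (A \<union> B)"
proof -
  obtain F where F: "finite F" "F \<subseteq> carrier R" "\<forall>t\<in>A. \<exists>u\<in>F. t \<ominus> u \<in> m"
    using assms(1) unfolding finite_mod_def by blast
  obtain G where G: "finite G" "G \<subseteq> carrier R" "\<forall>t\<in>B. \<exists>u\<in>G. t \<ominus> u \<in> m"
    using assms(2) unfolding finite_mod_def by blast
  show ?thesis unfolding finite_mod_def
    by (rule exI[of _ "F \<union> G"]) (use F G in blast)
qed

text \<open>Serves to read the parameter of a line from its other end.\<close>

lemma finite_mod_one_minus:
  assumes "finite_mod B" "B \<subseteq> carrier R"
  shows "finite_mod {t \<in> carrier R. \<one> \<ominus> t \<in> B}"
proof -
  obtain F where F: "finite F" "F \<subseteq> carrier R" "\<forall>t\<in>B. \<exists>u\<in>F. t \<ominus> u \<in> m"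
    using assms(1) unfolding finite_mod_def by blast
  have "\<exists>u\<in>(\<lambda>u. \<one> \<ominus> u) ` F. t \<ominus> u \<in> m" if t: "t \<in> carrier R" "\<one> \<ominus> t \<in> B" for t
  proof -
    obtain u where u: "u \<in> F" "\<one> \<ominus> t \<ominus> u \<in> m" using F t by blast
    then have uc: "u \<in> carrier R" using F by blast
    have "\<ominus> (\<one> \<ominus> t \<ominus> u) \<in> m"
      by (rule additive_subgroup.a_inv_closed[OF ideal.axioms(1)[OF ideal_m] u(2)])
    moreover have "\<ominus> (\<one> \<ominus> t \<ominus> u) = t \<ominus> (\<one> \<ominus> u)" using uc t by algebra
    ultimately show ?thesis using u by auto
  qed
  then show ?thesis unfolding finite_mod_def
    by (intro exI[of _ "(\<lambda>u. \<one> \<ominus> u) ` F"]) (use F in auto)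
qed

lemma incongruent_sequence:
  assumes "\<not> finite_mod B" "B \<subseteq> carrier R"
  shows "\<exists>t :: nat \<Rightarrow> 'a. (\<forall>i<k. t i \<in> B) \<and> (\<forall>i<k. \<forall>j<i. t i \<ominus> t j \<notin> m)"
proof (induct k)
  case (Suc k)
  then obtain t :: "nat \<Rightarrow> 'a" where t: "\<forall>i<k. t i \<in> B" "\<forall>i<k. \<forall>j<i. t i \<ominus> t j \<notin> m"
    by blast
  have "t ` {..<k} \<subseteq> carrier R" using t(1) assms(2) by blast
  moreover have "finite (t ` {..<k})" by simp
  ultimately have "\<not> (\<forall>u\<in>B. \<exists>v\<in>t ` {..<k}. u \<ominus> v \<in> m)"
    using assms(1) unfolding finite_mod_def by blast
  then obtain u where u: "u \<in> B" "\<forall>i<k. u \<ominus> t i \<notin> m" by blast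
  have "(\<forall>i<Suc k. (t(k := u)) i \<in> B) \<and>
      (\<forall>i<Suc k. \<forall>j<i. (t(k := u)) i \<ominus> (t(k := u)) j \<notin> m)"
    using t u by (simp add: less_Suc_eq)
  then show ?case by blast
qed simp

text \<open>A matrix pencil \<open>A + t B\<close> with \<open>A\<close> surjective is surjective for all but finitely many \<open>t\<close>:
  the images at pairwise distinct bad parameters intersect in a strictly decreasing sequence.\<close>

lemma pencil_finite_mod:
  assumes N: "ideal N R" and M: "ideal M R"
    and D: "\<And>t. t \<in> carrier R \<Longrightarrow> ideal (D t) R \<and> N \<subseteq> D t \<and> D t \<subseteq> M"
    and mM: "m \<cdot> M \<subseteq> N"
    and pencil: "\<And>w. w \<in> M \<Longrightarrow> \<exists>w'\<in>M. \<forall>t\<in>carrier R. w \<oplus> t \<otimes> w' \<in> D t"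
    and fin: "len N M < \<infinity>"
  shows "finite_mod {t \<in> carrier R. D t \<noteq> M}"
proof (rule ccontr)
  assume nf: "\<not> finite_mod {t \<in> carrier R. D t \<noteq> M}"
  have NM: "N \<subseteq> M" using D[OF zero_closed] by blast
  have chain: "chain_ge N M k" for k
  proof -
    obtain t :: "nat \<Rightarrow> 'a" where t: "\<forall>i<k. t i \<in> {t \<in> carrier R. D t \<noteq> M}"
      and inc: "\<forall>i<k. \<forall>j<i. t i \<ominus> t j \<notin> m"
      using incongruent_sequence[OF nf, of k] by blast
    have tc: "t i \<in> carrier R" "D (t i) \<noteq> M" if "i < k" for i using t that by blast+
    have idD: "ideal (D (t i)) R" "N \<subseteq> D (t i)" "D (t i) \<subseteq> M" if "i < k" for i
      using D[OF tc(1)[OF that]] by blast+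
    \<comment> \<open>For \<open>t i\<close> in \<open>m\<close> the term
      \<open>t i \<otimes> w'\<close> lies in \<open>m \<cdot> M \<subseteq> N\<close>, so
      \<open>D (t i)\<close> would contain all of \<open>M\<close> and the parameter would not be
      bad.\<close>
    have unit: "t i \<notin> m" if i: "i < k" for i
    proof
      assume ti: "t i \<in> m"
      have "M \<subseteq> D (t i)"
      proof
        fix w assume w: "w \<in> M"
        then obtain w' where w': "w' \<in> M" "w \<oplus> t i \<otimes> w' \<in> D (t i)"
          using pencil[OF w] tc(1)[OF i] by blast
        have "t i \<otimes> w' \<in> D (t i)"
          using ideal_prod.prod[OF ti w'(1), of R] mM idD[OF i] by blast
        then have "w \<oplus> t i \<otimes> w' \<ominus> t i \<otimes> w' \<in> D (t i)"
          unfolding minus_eq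
          by (intro additive_subgroup.a_closed[OF ideal.axioms(1)[OF idD(1)[OF i]]] w'(2)
              additive_subgroup.a_inv_closed[OF ideal.axioms(1)[OF idD(1)[OF i]]])
        moreover have "w \<oplus> t i \<otimes> w' \<ominus> t i \<otimes> w' = w"
          using ideal.Icarr[OF M w] ideal.Icarr[OF M w'(1)] tc(1)[OF i] by algebra
        ultimately show "w \<in> D (t i)" by simp
      qed
      then show False using idD(3)[OF i] tc(2)[OF i] by blast
    qed
    define X where "X j = {w \<in> M. \<forall>i<j. w \<in> D (t i)}" for j :: nat
    have X0: "X 0 = M" by (simp add: X_def)
    have XSuc: "X (Suc j) = X j \<inter> D (t j)" for j by (auto simp: X_def less_Suc_eq)
    have idX: "ideal (X j) R" if "j \<le> k" for j
      using that
    \<comment> \<open>The members of the descending sequence are ideals as long as only the first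
      \<open>k\<close> parameters are imposed.\<close>
    proof (induct j)
      case (Suc j)
      then show ?case unfolding XSuc by (intro i_intersect idD) simp_all
    qed (simp add: X0 M)
    \<comment> \<open>None of the conditions \<open>D (t l)\<close> with \<open>l \<ge> j\<close>
      follows from the first \<open>j\<close> conditions. The case \<open>l = j\<close> makes the
      sequence \<open>X\<close> strictly decreasing; the other values of \<open>l\<close> are needed
      for the induction.\<close>
    have ex: "\<exists>w\<in>X j. w \<notin> D (t l)" if "j \<le> l" "l < k" for j l
      using that
    proof (induct j arbitrary: l)
      case 0
      then show ?case using idD(3)[of l] tc(2)[of l] unfolding X0 by blast
    next
      case (Suc j)
      then have jk: "j < k" and lk: "l < k" and jl: "j < l" by simp_all
      obtain w where w: "w \<in> X j" "w \<notin> D (t l)" using Suc by (meson Suc_leD)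
      have wM: "w \<in> M" using w(1) by (simp add: X_def)
      obtain w' where w': "w' \<in> M" and p: "\<forall>t\<in>carrier R. w \<oplus> t \<otimes> w' \<in> D t"
        using pencil[OF wM] by blast
      have wc: "w \<in> carrier R" "w' \<in> carrier R"
        using ideal.Icarr[OF M wM] ideal.Icarr[OF M w'] .
      have diff: "a \<ominus> b \<in> D (t i)" if "i < k" "a \<in> D (t i)" "b \<in> D (t i)" for i a b
        unfolding minus_eq using that
        by (intro additive_subgroup.a_closed[OF ideal.axioms(1)[OF idD(1)[OF that(1)]]]
              additive_subgroup.a_inv_closed[OF ideal.axioms(1)[OF idD(1)[OF that(1)]]])
      \<comment> \<open>Both \<open>w\<close> and \<open>w \<oplus> t i \<otimes> w'\<close> lie in
        \<open>D (t i)\<close>, and \<open>t i\<close> is a unit.\<close>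
      have "w' \<in> D (t i)" if i: "i < j" for i
      proof -
        have ik: "i < k" using i jk by simp
        have "w \<in> D (t i)" using w(1) i by (simp add: X_def)
        then have "w \<oplus> t i \<otimes> w' \<ominus> w \<in> D (t i)"
          using diff[OF ik] p tc(1)[OF ik] by blast
        moreover have "w \<oplus> t i \<otimes> w' \<ominus> w = t i \<otimes> w'" using wc tc(1)[OF ik] by algebra
        ultimately show ?thesis
          using unit_cancel[OF idD(1)[OF ik] tc(1)[OF ik] unit[OF ik] wc(2)] by simp
      qed
      then have w'X: "w' \<in> X j" using w' by (simp add: X_def)
      \<comment> \<open>The correction moves \<open>w\<close> into \<open>D (t j)\<close>. If it
        moved it into \<open>D (t l)\<close> too, the difference with
        \<open>w \<oplus> t l \<otimes> w'\<close> would put \<open>w'\<close> there, because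
        \<open>t l \<ominus> t j\<close> is a unit, and then \<open>w\<close> as well.\<close>
      define u where "u = w \<oplus> t j \<otimes> w'"
      have "u \<in> X j" unfolding u_def
        using idX[of j] jk w(1) w'X tc(1)[OF jk]
        by (intro additive_subgroup.a_closed[OF ideal.axioms(1)] ideal.I_l_closed) simp_all
      then have "u \<in> X (Suc j)" unfolding XSuc using p tc(1)[OF jk] u_def by blast
      moreover have "u \<notin> D (t l)"
      proof
        assume u: "u \<in> D (t l)"
        have q: "w \<oplus> t l \<otimes> w' \<in> D (t l)" using p tc(1)[OF lk] by blast
        have "w \<oplus> t l \<otimes> w' \<ominus> u \<in> D (t l)" by (rule diff[OF lk q u])
        moreover have "w \<oplus> t l \<otimes> w' \<ominus> u = (t l \<ominus> t j) \<otimes> w'"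
          unfolding u_def using wc tc(1)[OF lk] tc(1)[OF jk] by algebra
        ultimately have "w' \<in> D (t l)"
          using unit_cancel[OF idD(1)[OF lk] _ _ wc(2), of "t l \<ominus> t j"] inc lk jl
            tc(1)[OF lk] tc(1)[OF jk] by simp
        then have "t l \<otimes> w' \<in> D (t l)"
          using ideal.I_l_closed[OF idD(1)[OF lk] _ tc(1)[OF lk]] by blast
        then have "w \<oplus> t l \<otimes> w' \<ominus> t l \<otimes> w' \<in> D (t l)" by (rule diff[OF lk q])
        moreover have "w \<oplus> t l \<otimes> w' \<ominus> t l \<otimes> w' = w" using wc tc(1)[OF lk] by algebra
        ultimately show False using w(2) by simp
      qed
      ultimately show ?case by blast
    qed
    have "chain_ge (X j) M j" if "j \<le> k" for j
      using that
    proof (induct j)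
      case 0
      then show ?case using M by (simp add: X0 chain_ge.base)
    next
      case (Suc j)
      then have jk: "j < k" by simp
      have "X (Suc j) \<subset> X j" using ex[OF order_refl jk] unfolding XSuc by blast
      then have "chain_ge (X (Suc j)) (X j) (Suc 0)"
        using idX Suc.prems by (intro chain_ge.step[OF chain_ge.base]) simp_all
      then show ?case
        using chain_ge_trans[of "X j" M j "X (Suc j)" "Suc 0"] Suc by simp
    qed
    moreover have "chain_ge N (X k) 0"
      using idX[of k] N NM idD(2) by (intro chain_ge.base) (auto simp: X_def)
    ultimately show ?thesis
      using chain_ge_trans[of "X k" M k N 0] by simp
  qed
  then have le: "enat k \<le> len N M" for k using len_ge_iff[OF N M NM] by simp
  obtain l where "len N M = enat l" using fin by (cases "len N M") auto
  then show False using le[of "Suc l"] by simp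
qed

text \<open>Line-openness stands in for Zariski openness: it needs no polynomials, and nonempty line-open
  sets meet because a line joining points of the two sets has few bad parameters for either.\<close>

definition line_open :: "'a set \<Rightarrow> (nat \<Rightarrow> 'a) set \<Rightarrow> bool" where
  "line_open I U \<longleftrightarrow> (\<forall>y\<in>U. \<forall>v. range v \<subseteq> I \<longrightarrow> finite_mod {t \<in> carrier R. (\<lambda>i. y i \<oplus> t \<otimes> v i) \<notin> U})"

lemma line_open_Int:
  assumes "line_open I U" "line_open I V"
  shows "line_open I (U \<inter> V)"
  unfolding line_open_def
proof (intro ballI allI impI)
  fix y v :: "nat \<Rightarrow> 'a" assume "y \<in> U \<inter> V" "range v \<subseteq> I"
  then have "finite_mod {t \<in> carrier R. (\<lambda>i. y i \<oplus> t \<otimes> v i) \<notin> U}"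
    "finite_mod {t \<in> carrier R. (\<lambda>i. y i \<oplus> t \<otimes> v i) \<notin> V}"
    using assms unfolding line_open_def by blast+
  from finite_mod_Un[OF this] show "finite_mod {t \<in> carrier R. (\<lambda>i. y i \<oplus> t \<otimes> v i) \<notin> U \<inter> V}"
    by (rule finite_mod_subset) blast
qed

end

locale noetherian_local_ring_inf = noetherian_local_ring +
  assumes infinite_residue_field: "infinite (carrier (R Quot m))"
begin

lemma not_finite_mod_carrier: "\<not> finite_mod (carrier R)"
proof
  assume "finite_mod (carrier R)"
  then obtain F where F: "finite F" "F \<subseteq> carrier R" "\<forall>t\<in>carrier R. \<exists>u\<in>F. t \<ominus> u \<in> m"
    unfolding finite_mod_def by blast
  have "carrier (R Quot m) \<subseteq> (\<lambda>u. m +> u) ` F"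
  proof
    fix X assume "X \<in> carrier (R Quot m)"
    then obtain t where t: "t \<in> carrier R" "X = m +> t"
      unfolding FactRing_def A_RCOSETS_def' by auto
    obtain u where u: "u \<in> F" "t \<ominus> u \<in> m" using F t by blast
    have "m +> t = m +> u"
      using quotient_eq_iff_same_a_r_cos[OF ideal_m t(1), of u] u F by blast
    then show "X \<in> (\<lambda>u. m +> u) ` F" using t u by blast
  qed
  then show False using infinite_residue_field F(1) finite_surj by blast
qed

lemma line_open_meet:
  assumes I: "ideal I R" and U: "line_open I U" "U \<subseteq> {y. range y \<subseteq> I}" "U \<noteq> {}"
    and V: "line_open I V" "V \<subseteq> {y. range y \<subseteq> I}" "V \<noteq> {}"
  shows "U \<inter> V \<noteq> {}"
proof -
  obtain y z where yz: "y \<in> U" "z \<in> V" using U V by blast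
  have yI: "y i \<in> I" "z i \<in> I" for i using yz U V by blast+
  have carr: "y i \<in> carrier R" "z i \<in> carrier R" for i using yI ideal.Icarr[OF I] by blast+
  let ?v = "\<lambda>i. z i \<ominus> y i" and ?v' = "\<lambda>i. y i \<ominus> z i"
  have diff: "a \<ominus> b \<in> I" if "a \<in> I" "b \<in> I" for a b
    unfolding minus_eq using that
    by (intro additive_subgroup.a_closed[OF ideal.axioms(1)[OF I]]
              additive_subgroup.a_inv_closed[OF ideal.axioms(1)[OF I]])
  have v: "range ?v \<subseteq> I" "range ?v' \<subseteq> I" using diff yI by blast+
  define B where "B = {t \<in> carrier R. (\<lambda>i. y i \<oplus> t \<otimes> ?v i) \<notin> U}"
  define B' where "B' = {t \<in> carrier R. (\<lambda>i. z i \<oplus> t \<otimes> ?v' i) \<notin> V}"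
  have "finite_mod B" "finite_mod B'" using U(1) V(1) yz v unfolding line_open_def B_def B'_def by blast+
  then have "finite_mod (B \<union> {t \<in> carrier R. \<one> \<ominus> t \<in> B'})"
    by (intro finite_mod_Un finite_mod_one_minus) (simp_all add: B'_def)
  then have "\<not> carrier R \<subseteq> B \<union> {t \<in> carrier R. \<one> \<ominus> t \<in> B'}"
    using not_finite_mod_carrier by (intro notI) (drule (1) finite_mod_subset, simp)
  then obtain t where t: "t \<in> carrier R" "t \<notin> B" "\<one> \<ominus> t \<notin> B'" by blast
  \<comment> \<open>The parameter \<open>t\<close> counted from \<open>y\<close> and the parameter 1
    - t counted from \<open>z\<close> name the same point of the line.\<close>
  have "(\<lambda>i. y i \<oplus> t \<otimes> ?v i) = (\<lambda>i. z i \<oplus> (\<one> \<ominus> t) \<otimes> ?v' i)"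
  proof
    fix i show "y i \<oplus> t \<otimes> ?v i = z i \<oplus> (\<one> \<ominus> t) \<otimes> ?v' i"
      using carr[of i] t(1) by algebra
  qed
  moreover have "(\<lambda>i. y i \<oplus> t \<otimes> ?v i) \<in> U" using t B_def by blast
  moreover have "(\<lambda>i. z i \<oplus> (\<one> \<ominus> t) \<otimes> ?v' i) \<in> V" using t minus_closed[OF one_closed t(1)] B'_def by blast
  ultimately show ?thesis by auto
qed

lemma line_open_finite_meet:
  assumes I: "ideal I R" and "finite Z"
    and U: "\<And>z. z \<in> Z \<Longrightarrow> line_open I (U z) \<and> U z \<subseteq> {y :: nat \<Rightarrow> 'a. range y \<subseteq> I} \<and> U z \<noteq> {}"
  shows "\<exists>y. range y \<subseteq> I \<and> (\<forall>z\<in>Z. y \<in> U z)"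
proof -
  \<comment> \<open>The space of all sequences in \<open>I\<close> is included in the intersection
    so that an empty \<open>Z\<close> gives a line-open set to start from.\<close>
  let ?T = "{y :: nat \<Rightarrow> 'a. range y \<subseteq> I}"
  have "line_open I (?T \<inter> (\<Inter>z\<in>Z. U z)) \<and> ?T \<inter> (\<Inter>z\<in>Z. U z) \<noteq> {}"
    using assms(2) U
  proof (induct Z)
    case empty
    have "\<zero> \<in> I" by (rule additive_subgroup.zero_closed[OF ideal.axioms(1)[OF I]])
    then have "(\<lambda>_. \<zero>) \<in> ?T" by auto
    moreover have "line_open I ?T"
      unfolding line_open_def
    proof (intro ballI allI impI)
      fix y v :: "nat \<Rightarrow> 'a" assume yv: "y \<in> ?T" "range v \<subseteq> I"
      have "(\<lambda>i. y i \<oplus> t \<otimes> v i) \<in> ?T" if "t \<in> carrier R" for t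
      proof -
        have "y i \<oplus> t \<otimes> v i \<in> I" for i
          using yv that
          by (intro additive_subgroup.a_closed[OF ideal.axioms(1)[OF I]] ideal.I_l_closed[OF I]) blast+
        then show ?thesis by blast
      qed
      then have "{t \<in> carrier R. (\<lambda>i. y i \<oplus> t \<otimes> v i) \<notin> ?T} = {}" by blast
      then show "finite_mod {t \<in> carrier R. (\<lambda>i. y i \<oplus> t \<otimes> v i) \<notin> ?T}"
        unfolding finite_mod_def by (metis empty_iff empty_subsetI finite.emptyI)
    qed
    ultimately show ?case by auto
  next
    case (insert z Z)
    have *: "?T \<inter> (\<Inter>z\<in>insert z Z. U z) = U z \<inter> (?T \<inter> (\<Inter>z\<in>Z. U z))" by blast
    have IH: "line_open I (?T \<inter> (\<Inter>z\<in>Z. U z))" "?T \<inter> (\<Inter>z\<in>Z. U z) \<noteq> {}"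
      using insert by simp_all
    have Uz: "line_open I (U z)" "U z \<subseteq> ?T" "U z \<noteq> {}" using insert.prems[of z] by simp_all
    show ?case unfolding *
      by (intro conjI line_open_Int Uz IH line_open_meet[OF I]) blast
  qed
  then show ?thesis by blast
qed

end

section \<open>Spanning conditions are open along lines\<close>

context noetherian_local_ring
begin

text \<open>Keep the coefficients: if \<open>w\<close> is the sum of the y_i a_i, then
  \<open>w'\<close> is the sum of the v_i a_i. It does not depend on \<open>t\<close>, which is what
  makes the spans a pencil.\<close>

lemma span_by_perturb:
  fixes y v :: "nat \<Rightarrow> 'a"
  assumes A: "ideal A R" and y: "\<forall>i. y i \<in> carrier R" and v: "\<forall>i. v i \<in> carrier R"
    and w: "w \<in> span_by R y k A"
  shows "\<exists>w'\<in>span_by R v k A. \<forall>t\<in>carrier R. w \<oplus> t \<otimes> w' \<in> span_by R (\<lambda>i. y i \<oplus> t \<otimes> v i) k A"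
  using w
proof (induct k arbitrary: w)
  case 0
  then show ?case by simp
next
  case (Suc k)
  then obtain w1 a where w: "w1 \<in> span_by R y k A" "a \<in> A" "w = w1 \<oplus> y k \<otimes> a"
    unfolding span_by.simps set_add_iff by blast
  obtain w1' where w1': "w1' \<in> span_by R v k A"
    and p: "\<forall>t\<in>carrier R. w1 \<oplus> t \<otimes> w1' \<in> span_by R (\<lambda>i. y i \<oplus> t \<otimes> v i) k A"
    using Suc.hyps[OF w(1)] by blast
  have id: "ideal (span_by R y k A) R" "ideal (span_by R v k A) R"
    using y v by (intro span_by_ideal A; blast)+
  have carr: "w1 \<in> carrier R" "w1' \<in> carrier R" "a \<in> carrier R" "y k \<in> carrier R" "v k \<in> carrier R"
    using ideal.Icarr[OF id(1) w(1)] ideal.Icarr[OF id(2) w1'] ideal.Icarr[OF A w(2)] y v by blast+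
  show ?case
  proof (rule bexI[of _ "w1' \<oplus> v k \<otimes> a"], rule ballI)
    show "w1' \<oplus> v k \<otimes> a \<in> span_by R v (Suc k) A"
      unfolding span_by.simps set_add_iff using w1' w(2) by blast
    fix t assume t: "t \<in> carrier R"
    have "w \<oplus> t \<otimes> (w1' \<oplus> v k \<otimes> a) = (w1 \<oplus> t \<otimes> w1') \<oplus> (y k \<oplus> t \<otimes> v k) \<otimes> a"
      unfolding w(3) using carr t by algebra
    then show "w \<oplus> t \<otimes> (w1' \<oplus> v k \<otimes> a) \<in> span_by R (\<lambda>i. y i \<oplus> t \<otimes> v i) (Suc k) A"
      unfolding span_by.simps set_add_iff using p t w(2) by blast
  qed
qed

text \<open>Along a line the ideals \<open>span_by R (y + t v) s A <+> N\<close> satisfy the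
  hypotheses of \<open>pencil_finite_mod\<close>: at t = 0 they fill \<open>I \<cdot> A\<close>, and
  \<open>span_by_perturb\<close> carries each element of it along.\<close>

lemma line_open_span:
  assumes I: "ideal I R" and A: "ideal A R" and N: "ideal N R"
    and NM: "N \<subseteq> I \<cdot> A" and mM: "m \<cdot> (I \<cdot> A) \<subseteq> N" and fin: "len N (I \<cdot> A) < \<infinity>"
  shows "line_open I {y. range y \<subseteq> I \<and> span_by R y s A <+> N = I \<cdot> A}"
  unfolding line_open_def
proof (intro ballI allI impI)
  fix y v :: "nat \<Rightarrow> 'a"
  assume "y \<in> {y. range y \<subseteq> I \<and> span_by R y s A <+> N = I \<cdot> A}" and vI: "range v \<subseteq> I"
  then have yI: "range y \<subseteq> I" and yM: "span_by R y s A <+> N = I \<cdot> A" by blast+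
  let ?M = "I \<cdot> A"
  have M: "ideal ?M R" by (rule ideal_prod_is_ideal[OF I A])
  have spanM: "ideal (span_by R z s A) R \<and> span_by R z s A \<subseteq> ?M" if "\<forall>i. z i \<in> I" for z :: "nat \<Rightarrow> 'a"
  proof
    show "ideal (span_by R z s A) R"
      using that ideal.Icarr[OF I] by (intro span_by_ideal A) blast
    show "span_by R z s A \<subseteq> ?M"
      using that by (intro span_by_least[OF M] ideal_prod.prod) blast+
  qed
  define Y where "Y t = (\<lambda>i. y i \<oplus> t \<otimes> v i)" for t
  have YI: "\<forall>i. Y t i \<in> I" if "t \<in> carrier R" for t
  proof
    fix i show "Y t i \<in> I"
      unfolding Y_def using yI vI that
      by (intro additive_subgroup.a_closed[OF ideal.axioms(1)[OF I]] ideal.I_l_closed[OF I]) blast+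
  qed
  define D where "D t = span_by R (Y t) s A <+> N" for t
  have "finite_mod {t \<in> carrier R. D t \<noteq> ?M}"
  proof (rule pencil_finite_mod[OF N M _ mM _ fin])
    fix t assume t: "t \<in> carrier R"
    show "ideal (D t) R \<and> N \<subseteq> D t \<and> D t \<subseteq> ?M"
      unfolding D_def using spanM[OF YI[OF t]] N NM
      by (intro conjI add_ideals set_add_upper set_add_least[OF M]) blast+
  next
    fix w assume "w \<in> ?M"
    then obtain w1 n where w: "w1 \<in> span_by R y s A" "n \<in> N" "w = w1 \<oplus> n"
      unfolding yM[symmetric] set_add_iff by blast
    have yc: "\<forall>i. y i \<in> carrier R" "\<forall>i. v i \<in> carrier R"
      using yI vI ideal_subset_carrier[OF I] by blast+
    obtain w' where w': "w' \<in> span_by R v s A"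
      and p: "\<forall>t\<in>carrier R. w1 \<oplus> t \<otimes> w' \<in> span_by R (Y t) s A"
      using span_by_perturb[OF A yc w(1)] unfolding Y_def by blast
    have vv: "\<forall>i. v i \<in> I" "\<forall>i. y i \<in> I" using vI yI by blast+
    have w'M: "w' \<in> ?M" using spanM[OF vv(1)] w' by blast
    have w1M: "w1 \<in> ?M" using spanM[OF vv(2)] w by blast
    show "\<exists>w'\<in>?M. \<forall>t\<in>carrier R. w \<oplus> t \<otimes> w' \<in> D t"
    proof (rule bexI[OF _ w'M], rule ballI)
      fix t assume t: "t \<in> carrier R"
      have "w \<oplus> t \<otimes> w' = (w1 \<oplus> t \<otimes> w') \<oplus> n"
        unfolding w(3) using ideal.Icarr[OF M w1M] ideal.Icarr[OF M w'M] ideal.Icarr[OF N w(2)] t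
        by algebra
      then show "w \<oplus> t \<otimes> w' \<in> D t"
        unfolding D_def set_add_iff using p t w(2) by blast
    qed
  qed
  then show "finite_mod {t \<in> carrier R. (\<lambda>i. y i \<oplus> t \<otimes> v i) \<notin> {y. range y \<subseteq> I \<and> span_by R y s A <+> N = ?M}}"
  proof (rule finite_mod_subset)
    show "{t \<in> carrier R. (\<lambda>i. y i \<oplus> t \<otimes> v i) \<notin> {y. range y \<subseteq> I \<and> span_by R y s A <+> N = ?M}}
        \<subseteq> {t \<in> carrier R. D t \<noteq> ?M}"
      using YI unfolding D_def Y_def by auto
  qed
qed

end

section \<open>Generators of powers of an ideal\<close>

text \<open>Source of the constant. By absorption (p + 1) C(k+p+1, k) = (k + p + 1) C(k+p, k), so
  the hypothesis times C(k+p, k) reads e C(k+p, k) < C(k+p+1, k) + C(k+p, k) after division by p +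
  1. Applying Pascal's rule twice to the right-hand side of the claim gives these two terms and
  C(k+p, k+1).\<close>

lemma binomial_bound:
  assumes "Suc p * e < k + 2 * Suc p"
  shows "e * (k + p choose k) + (k + p choose Suc k) < (Suc k + Suc p choose Suc p)"
proof -
  let ?a = "k + p choose k" and ?b = "k + p choose Suc k" and ?c = "Suc (k + p) choose k"
  have "(Suc (k + p) - k) * ?c = Suc (k + p) * (Suc (k + p) - 1 choose k)"
    by (rule binomial_absorb_comp)
  then have c: "Suc p * ?c = Suc (k + p) * ?a" by (simp add: Suc_diff_le)
  have "(Suc p * e) * ?a < (k + 2 * Suc p) * ?a"
    using assms by (intro mult_strict_right_mono) (simp_all add: zero_less_binomial)
  then have "Suc p * (e * ?a) < Suc p * (?c + ?a)"
    using c by (simp add: algebra_simps)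
  then have "e * ?a < ?c + ?a" by (simp only: mult_less_cancel1)
  moreover have "(Suc k + Suc p choose Suc p) = ?c + ?a + ?b"
  proof -
    have "(Suc k + Suc p choose Suc p) = (Suc k + Suc p choose Suc k)"
      using binomial_symmetric[of "Suc p" "Suc k + Suc p"] by simp
    also have "\<dots> = ?c + ?a + ?b" by simp
    finally show ?thesis .
  qed
  ultimately show ?thesis by simp
qed

context cring
begin

lemma span_by_mult_mem:
  assumes "ideal I R" "ideal A R" "\<forall>i<k. y i \<in> carrier R" "z \<in> I" "p \<in> span_by R y k A"
  shows "z \<otimes> p \<in> span_by R y k (I \<cdot> A)"
proof -
  have yc: "i < k \<Longrightarrow> y i \<in> carrier R" for i using assms(3) by blast
  have G: "ideal (gen_by R y k) R" by (rule span_by_ideal[OF yc oneideal])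
  have "p \<in> gen_by R y k \<cdot> A" using assms(5) span_by_eq_prod[OF yc assms(2)] by simp
  then have "z \<otimes> p \<in> I \<cdot> (gen_by R y k \<cdot> A)" by (rule ideal_prod.prod[OF assms(4)])
  then show ?thesis
    using ideal_prod_left_commute[OF assms(1) G assms(2)]
      span_by_eq_prod[OF yc ideal_prod_is_ideal[OF assms(1,2)]] by simp
qed

lemma pow_mem_ideal_pow:
  "a \<in> A \<Longrightarrow> ideal A R \<Longrightarrow> a [^] (n::nat) \<in> ideal_pow R A n"
proof (induct n)
  case (Suc n)
  have ac: "a \<in> carrier R" using ideal.Icarr[OF Suc.prems(2,1)] .
  have "a \<otimes> a [^] n \<in> A \<cdot> ideal_pow R A n"
    using Suc by (intro ideal_prod.prod) simp_all
  then show ?case using ac by (simp add: m_comm)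
qed simp

text \<open>Adjoining an element of \<open>C\<close> that is not yet in the ideal raises it by
  length at least one, so \<open>l\<close> choices exhaust \<open>A <+> C\<close>.\<close>

lemma greedy_generators:
  assumes "ideal A R" "ideal C R" "len A (A <+> C) \<le> enat l"
  shows "\<exists>z. (\<forall>i<l. z i \<in> C) \<and> A <+> C = A <+> gen_by R z l"
  using assms(1,3)
proof (induct l arbitrary: A)
  case 0
  have AC: "ideal (A <+> C) R" "A \<subseteq> A <+> C"
    using 0 assms(2) by (intro add_ideals set_add_upper; simp)+
  have "len A (A <+> C) < 1"
    using 0(2) by (simp add: zero_enat_def[symmetric])
  then have "A = A <+> C" using len_zero_iff[OF 0(1) AC] by simp
  moreover have "A <+> {\<zero>} = A"
    using set_add_absorb(2)[OF zeroideal 0(1)]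
      additive_subgroup.zero_closed[OF ideal.axioms(1)[OF 0(1)]] by simp
  ultimately show ?case by simp
next
  case (Suc l)
  have AC: "ideal (A <+> C) R" "A \<subseteq> A <+> C" "C \<subseteq> A <+> C"
    using Suc assms(2) by (intro add_ideals set_add_upper; simp)+
  \<comment> \<open>Once \<open>C\<close> is contained in \<open>A\<close> the list is padded with
    zeros to have exactly \<open>l\<close> entries.\<close>
  define c where "c = (if C \<subseteq> A then \<zero> else SOME c. c \<in> C \<and> c \<notin> A)"
  have cC: "c \<in> C" "\<not> C \<subseteq> A \<Longrightarrow> c \<notin> A"
  proof -
    have "c \<in> C \<and> c \<notin> A" if n: "\<not> C \<subseteq> A"
    proof -
      have "\<exists>c. c \<in> C \<and> c \<notin> A" using n by blast
      then have "(SOME c. c \<in> C \<and> c \<notin> A) \<in> C \<and> (SOME c. c \<in> C \<and> c \<notin> A) \<notin> A" by (rule someI_ex)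
      then show ?thesis using n by (simp add: c_def)
    qed
    then show "c \<in> C" "\<not> C \<subseteq> A \<Longrightarrow> c \<notin> A"
      using additive_subgroup.zero_closed[OF ideal.axioms(1)[OF assms(2)]] c_def by auto
  qed
  have cc: "c \<in> carrier R" using ideal.Icarr[OF assms(2) cC(1)] .
  let ?P = "(\<lambda>r. c \<otimes> r) ` carrier R"
  have P: "ideal ?P R" by (rule dilate_ideal[OF cc oneideal])
  have PC: "?P \<subseteq> C"
    using ideal.I_r_closed[OF assms(2) cC(1)] by blast
  have cP: "c \<in> ?P" using cc by (intro image_eqI[of _ _ "\<one>"]) simp_all
  define A1 where "A1 = A <+> ?P"
  have A1: "ideal A1 R" "A \<subseteq> A1" "?P \<subseteq> A1"
    unfolding A1_def by (intro add_ideals set_add_upper Suc.prems P)+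
  have A1C: "A1 <+> C = A <+> C"
    unfolding A1_def
    using set_add_assoc[OF ideal_subset_carrier ideal_subset_carrier ideal_subset_carrier,
        OF Suc.prems(1) P assms(2)] set_add_absorb(1)[OF P assms(2) PC] by simp
  have A1AC: "A1 \<subseteq> A <+> C" unfolding A1_def using PC by (intro set_add_mono) simp_all
  have "len A1 (A <+> C) \<le> enat l"
  proof (cases "C \<subseteq> A")
    case True
    then have "A <+> C = A" using set_add_absorb(2)[OF assms(2) Suc.prems(1)] by simp
    then have "A1 = A" using A1 A1AC by simp
    then show ?thesis using \<open>A <+> C = A\<close> len_self[OF Suc.prems(1)] by simp
  next
    case False
    then have "A \<subset> A1" using cC(2) A1 cP by blast
    then have "1 \<le> len A A1" by (rule len_pos[OF Suc.prems(1) A1(1)])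
    moreover have "len A A1 + len A1 (A <+> C) \<le> enat (Suc l)"
      using len_add[OF Suc.prems(1) A1(1) AC(1) A1(2) A1AC] Suc.prems(2) by simp
    ultimately show ?thesis
      by (cases "len A A1"; cases "len A1 (A <+> C)") (auto simp: one_enat_def)
  qed
  then obtain z where z: "\<forall>i<l. z i \<in> C" "A1 <+> C = A1 <+> gen_by R z l"
    using Suc.hyps[OF A1(1)] A1C by auto
  have zc: "i < l \<Longrightarrow> z i \<in> carrier R" for i using z(1) ideal.Icarr[OF assms(2)] by blast
  have Gz: "ideal (gen_by R z l) R" by (rule span_by_ideal[OF zc oneideal])
  have "gen_by R (z(l := c)) l = gen_by R z l" by (rule span_by_cong) simp
  then have "gen_by R (z(l := c)) (Suc l) = gen_by R z l <+> ?P" by simp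
  then have "A <+> gen_by R (z(l := c)) (Suc l) = A <+> (?P <+> gen_by R z l)"
    using set_add_comm[OF ideal_subset_carrier[OF Gz] ideal_subset_carrier[OF P]] by simp
  also have "\<dots> = A1 <+> gen_by R z l"
    unfolding A1_def
    by (rule set_add_assoc[symmetric]) (intro ideal_subset_carrier Suc.prems P Gz)+
  also have "\<dots> = A <+> C" using z A1C by simp
  finally have "A <+> C = A <+> gen_by R (z(l := c)) (Suc l)" ..
  moreover have "\<forall>i<Suc l. (z(l := c)) i \<in> C" using z(1) cC(1) by (simp add: less_Suc_eq)
  ultimately show ?case by blast
qed

text \<open>From I^(b+1) = J I^b follows I^(k+b) = J^k I^b for all k; for k = a + 1 the equation
  J^(a+1) = Q J^a then extracts a factor \<open>Q\<close>.\<close>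

lemma is_reduction_trans:
  assumes I: "ideal I R" and J: "is_reduction R J I" and Q: "is_reduction R Q J"
  shows "is_reduction R Q I"
proof -
  obtain a where a: "ideal_pow R J (Suc a) = Q \<cdot> ideal_pow R J a"
    using Q unfolding is_reduction_def by blast
  obtain b where b: "ideal_pow R I (Suc b) = J \<cdot> ideal_pow R I b"
    using J unfolding is_reduction_def by blast
  have id: "ideal J R" "ideal Q R" "Q \<subseteq> I" using J Q unfolding is_reduction_def by blast+
  note pw = ideal_pow_ideal[OF I] ideal_pow_ideal[OF id(1)]
  have k: "ideal_pow R I (k + b) = ideal_pow R J k \<cdot> ideal_pow R I b" for k
  proof (induct k)
    case 0
    then show ?case by (simp add: ideal_prod_carrier_left pw)
  next
    case (Suc k)
    have "ideal_pow R I (Suc k + b) = I \<cdot> (ideal_pow R J k \<cdot> ideal_pow R I b)"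
      using Suc by simp
    also have "\<dots> = ideal_pow R J k \<cdot> ideal_pow R I (Suc b)"
      unfolding ideal_pow.simps(2) by (rule ideal_prod_left_commute[OF I pw(2,1)])
    also have "\<dots> = ideal_pow R J (Suc k) \<cdot> ideal_pow R I b"
      unfolding b
      using ideal_prod_left_commute[OF pw(2) id(1) pw(1), of k b]
        ideal_prod_assoc[OF id(1) pw(2,1), of k b] by simp
    finally show ?case .
  qed
  have "ideal_pow R I (Suc (a + b)) = ideal_pow R J (Suc a) \<cdot> ideal_pow R I b"
    using k[of "Suc a"] by simp
  also have "\<dots> = Q \<cdot> (ideal_pow R J a \<cdot> ideal_pow R I b)"
    unfolding a by (rule ideal_prod_assoc[OF id(2) pw(2,1)])
  also have "\<dots> = Q \<cdot> ideal_pow R I (a + b)" unfolding k ..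
  finally show ?thesis unfolding is_reduction_def using id by blast
qed

lemma is_reduction_contains_power:
  assumes "ideal I R" "is_reduction R J I"
  shows "\<exists>r. ideal_pow R I r \<subseteq> J"
proof -
  obtain b where b: "ideal_pow R I (Suc b) = J \<cdot> ideal_pow R I b"
    using assms(2) unfolding is_reduction_def by blast
  have "ideal J R" using assms(2) unfolding is_reduction_def by blast
  then have "ideal_pow R I (Suc b) \<subseteq> J"
    unfolding b using ideal_prod_inter[of J "ideal_pow R I b"] ideal_pow_ideal[OF assms(1)] by blast
  then show ?thesis by blast
qed

text \<open>Let L be generated by the first \<open>p\<close> elements, q by all of them, and x =
  \<open>x p\<close>. The ideals T_j = L^j + x R descend from R. As q L^j lies in T_(j+1), the layer
  T_j / T_(j+1) is killed by q and spanned by the monomials of degree j in \<open>p\<close>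
  elements; their numbers for j \<le> k add up to \<open>k + p choose k\<close>.\<close>

lemma len_sum_power_dilate:
  assumes x: "\<forall>i<Suc p. x i \<in> carrier R"
  shows "len (ideal_pow R (gen_by R x p) (Suc k) <+> (\<lambda>b. x p \<otimes> b) ` carrier R) (carrier R)
    \<le> enat (k + p choose k) * len (gen_by R x (Suc p)) (carrier R)"
proof -
  let ?P = "(\<lambda>b. x p \<otimes> b) ` carrier R"
  let ?L = "gen_by R x p"
  let ?q = "gen_by R x (Suc p)"
  have P: "ideal ?P R" by (rule dilate_ideal[OF _ oneideal]) (simp add: x)
  have L: "ideal ?L R" by (rule span_by_ideal[OF _ oneideal]) (use x in simp)
  have q: "ideal ?q R" unfolding span_by.simps by (rule add_ideals[OF L P])
  note pw = ideal_pow_ideal[OF L]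
  let ?T = "\<lambda>j. ideal_pow R ?L j <+> ?P"
  have T: "ideal (?T j) R" for j by (rule add_ideals[OF pw P])
  have step: "len (?T (Suc j)) (?T j) \<le> enat (j + p - 1 choose j) * len ?q (carrier R)" for j
  proof -
    have sub: "ideal_pow R ?L (Suc j) \<subseteq> ideal_pow R ?L j"
      by (rule ideal_pow_antimono[OF L]) simp
    have "?T (Suc j) <+> ideal_pow R ?L j = ideal_pow R ?L (Suc j) <+> (?P <+> ideal_pow R ?L j)"
      by (rule set_add_assoc) (intro ideal_subset_carrier pw P)+
    also have "\<dots> = ideal_pow R ?L (Suc j) <+> (ideal_pow R ?L j <+> ?P)"
      using set_add_comm[OF ideal_subset_carrier[OF P] ideal_subset_carrier[OF pw[of j]]] by simp
    also have "\<dots> = ?T j"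
      by (rule set_add_absorb(1)[OF pw T])
        (rule order_trans[OF sub set_add_upper(1)[OF pw P]])
    finally have top: "?T (Suc j) <+> ideal_pow R ?L j = ?T j" .
    have "?q \<cdot> ideal_pow R ?L j = ?L \<cdot> ideal_pow R ?L j <+> ?P \<cdot> ideal_pow R ?L j"
      unfolding span_by.simps by (rule ideal_prod_distr(2)[OF pw L P])
    also have "\<dots> \<subseteq> ?T (Suc j)"
      unfolding ideal_pow.simps using ideal_prod_inter[OF P pw[of j]]
      by (intro set_add_mono) simp_all
    finally have "len (?T (Suc j)) (?T (Suc j) <+> ideal_pow R ?L j)
        \<le> enat (j + p - 1 choose j) * len ?q (carrier R)"
      by (intro len_add_power[OF q T]) (use x in simp)
    then show ?thesis unfolding top .
  qed
  have TT: "?T (Suc j) \<subseteq> ?T j" for j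
    using ideal_pow_antimono[OF L, of j "Suc j"] by (intro set_add_mono) simp_all
  have T0: "?T 0 = carrier R"
    using set_add_absorb(2)[OF P oneideal ideal_subset_carrier[OF P]] by simp
  have "len (?T (Suc k)) (carrier R) \<le> enat (k + p choose k) * len ?q (carrier R)"
  proof (induct k)
    case 0
    then show ?case using step[of 0] T0 by simp
  next
    case (Suc k)
    have "len (?T (Suc (Suc k))) (carrier R)
        = len (?T (Suc (Suc k))) (?T (Suc k)) + len (?T (Suc k)) (carrier R)"
      by (rule len_add[OF T T oneideal TT ideal_subset_carrier[OF T]])
    also have "\<dots> \<le> enat (Suc k + p - 1 choose Suc k) * len ?q (carrier R)
        + enat (k + p choose k) * len ?q (carrier R)"
      by (rule add_mono[OF step Suc])
    also have "\<dots> = enat ((k + p choose Suc k) + (k + p choose k)) * len ?q (carrier R)"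
      by (simp add: distrib_right flip: plus_enat_simps(1))
    also have "(k + p choose Suc k) + (k + p choose k) = (Suc k + p choose Suc k)" by simp
    finally show ?case .
  qed
  then show ?thesis .
qed

end

context noetherian_local_ring
begin

text \<open>Multiplying by one generator \<open>x\<close> compares \<open>a = I\<^sup>n\<close> with the whole ring; no Cohen--Macaulay
  hypothesis is needed since \<open>x R / x a\<close> is a quotient of \<open>R / a\<close>.\<close>

lemma len_power_fibre:
  assumes I: "ideal I R" "I \<subseteq> m" and x: "\<forall>i<Suc p. x i \<in> I"
    and prim: "ideal_pow R m c \<subseteq> I"
  shows "len (m \<cdot> ideal_pow R I (Suc k)) (ideal_pow R I (Suc k))
    \<le> enat (k + p choose k) * len (gen_by R x (Suc p)) (carrier R) + enat (k + p choose Suc k)"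
proof -
  let ?a = "ideal_pow R I (Suc k)"
  let ?P = "(\<lambda>b. x p \<otimes> b) ` carrier R"
  let ?L = "gen_by R x p"
  let ?Ln = "ideal_pow R ?L (Suc k)"
  have xc: "\<forall>i<Suc p. x i \<in> carrier R" using x ideal_subset_carrier[OF I(1)] by blast
  have xp: "x p \<in> carrier R" using xc by simp
  have P: "ideal ?P R" by (rule dilate_ideal[OF xp oneideal])
  have L: "ideal ?L R" by (rule span_by_ideal[OF _ oneideal]) (use xc in simp)
  have a: "ideal ?a R" by (rule ideal_pow_ideal[OF I(1)])
  have Ln: "ideal ?Ln R" by (rule ideal_pow_ideal[OF L])
  have LI: "?L \<subseteq> I" by (rule gen_by_least[OF I(1)]) (use x in simp)
  have Lna: "?Ln \<subseteq> ?a" by (rule ideal_pow_mono[OF LI])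
  have ma: "ideal (m \<cdot> ?a) R" "m \<cdot> ?a \<subseteq> ?a"
    using ideal_prod_is_ideal[OF ideal_m a] ideal_prod_inter[OF ideal_m a] by blast+
  have S: "ideal (m \<cdot> ?a <+> ?Ln) R" by (rule add_ideals[OF ma(1) Ln])
  have Sa: "m \<cdot> ?a <+> ?Ln \<subseteq> ?a" by (rule set_add_least[OF a ma(2) Lna])
  have xa: "ideal ((\<lambda>b. x p \<otimes> b) ` ?a) R" by (rule dilate_ideal[OF xp a])
  have xam: "(\<lambda>b. x p \<otimes> b) ` ?a \<subseteq> m \<cdot> ?a"
    using x I(2) by (intro image_subsetI ideal_prod.prod) auto
  let ?B = "?Ln <+> (\<lambda>b. x p \<otimes> b) ` ?a"
  have B: "ideal ?B R" by (rule add_ideals[OF Ln xa])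
  have Ba: "?B \<subseteq> ?a" using xam ma(2) Lna by (intro set_add_least[OF a]) blast+
  have BS: "?B \<subseteq> m \<cdot> ?a <+> ?Ln"
    using set_add_upper[OF ma(1) Ln] xam by (intro set_add_least[OF S]) blast+
  let ?T = "?Ln <+> ?P"
  have T: "ideal ?T R" by (rule add_ideals[OF Ln P])
  have aP: "(\<lambda>b. x p \<otimes> b) ` ?a \<subseteq> ?P" using ideal_subset_carrier[OF a] by (rule image_mono)
  have BT: "?B <+> ?P = ?T"
    using set_add_assoc[OF ideal_subset_carrier[OF Ln] ideal_subset_carrier[OF xa] ideal_subset_carrier[OF P]]
      set_add_absorb(1)[OF xa P aP] by simp
  have fin: "len ?a (carrier R) < \<infinity>"
  proof (rule len_finite[OF a])
    show "ideal_pow R m (c * Suc k) \<subseteq> ?a"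
      by (rule ideal_pow_mono[OF prim, of "Suc k", unfolded ideal_pow_mult[OF ideal_m]])
  qed
  \<comment> \<open>Multiplication by \<open>x p\<close> maps R onto \<open>?T\<close> modulo
    \<open>?B\<close> and carries \<open>?a\<close> into \<open>?B\<close>.\<close>
  have "len ?B ?T \<le> len ?a (carrier R)"
  proof -
    have C: "ideal {b \<in> carrier R. x p \<otimes> b \<in> ?B} R" by (rule colon_ideal_in[OF B oneideal xp])
    have "len ?B ?T = len {b \<in> carrier R. x p \<otimes> b \<in> ?B} (carrier R)"
      using len_dilate[OF B oneideal xp] unfolding BT .
    also have "\<dots> \<le> len ?a (carrier R)"
    proof (rule len_mono[OF a C oneideal])
      show "?a \<subseteq> {b \<in> carrier R. x p \<otimes> b \<in> ?B}"
        using set_add_upper(2)[OF Ln xa] ideal_subset_carrier[OF a] by blast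
    qed blast
    finally show ?thesis .
  qed
  \<comment> \<open>From \<open>?B\<close> the ring is reached through \<open>?a\<close> and through
    \<open>?T\<close>. Cancelling the finite length of R over \<open>?a\<close> will bound the
    length of \<open>?a\<close> over \<open>?B\<close> by that of R over \<open>?T\<close>.\<close>
  moreover have "len ?B ?a + len ?a (carrier R) = len ?B ?T + len ?T (carrier R)"
    using len_add[OF B a oneideal Ba ideal_subset_carrier[OF a]]
      len_add[OF B T oneideal _ ideal_subset_carrier[OF T]] set_add_upper(1)[OF B P]
    unfolding BT by simp
  ultimately have "len ?B ?a + len ?a (carrier R) \<le> len ?T (carrier R) + len ?a (carrier R)"
    by (simp only: add.commute[of "len ?T (carrier R)"] add_right_mono)
  then have BaT: "len ?B ?a \<le> len ?T (carrier R)"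
    using fin by (cases "len ?a (carrier R)"; cases "len ?B ?a"; cases "len ?T (carrier R)") auto
  \<comment> \<open>Modulo \<open>m \<cdot> ?a\<close>, each monomial of degree k + 1 in the first
    \<open>p\<close> elements adds length at most one.\<close>
  have "len (m \<cdot> ?a) (m \<cdot> ?a <+> ?Ln) \<le> enat (Suc k + p - 1 choose Suc k) * len m (carrier R)"
    by (rule len_add_power[OF ideal_m ma(1)])
      (use xc ideal_prod_mono[OF subset_refl Lna] in auto)
  then have 1: "len (m \<cdot> ?a) (m \<cdot> ?a <+> ?Ln) \<le> enat (k + p choose Suc k)"
    by (simp add: len_m)
  have "len (m \<cdot> ?a <+> ?Ln) ?a \<le> len ?B ?a" by (rule len_mono[OF B S a BS Sa])
  also note BaT
  also have "len ?T (carrier R)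
      \<le> enat (k + p choose k) * len (gen_by R x (Suc p)) (carrier R)"
    by (rule len_sum_power_dilate[OF xc])
  finally have 2: "len (m \<cdot> ?a <+> ?Ln) ?a
      \<le> enat (k + p choose k) * len (gen_by R x (Suc p)) (carrier R)" .
  have "len (m \<cdot> ?a) ?a = len (m \<cdot> ?a) (m \<cdot> ?a <+> ?Ln) + len (m \<cdot> ?a <+> ?Ln) ?a"
    by (rule len_add[OF ma(1) S a set_add_upper(1)[OF ma(1) Ln] Sa])
  also have "\<dots> \<le> enat (k + p choose Suc k)
      + enat (k + p choose k) * len (gen_by R x (Suc p)) (carrier R)"
    by (rule add_mono[OF 1 2])
  finally show ?thesis by (simp add: add.commute)
qed

end

section \<open>The Eakin--Sathaye theorem and the reductions it gives\<close>

context noetherian_local_ring_inf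
begin

text \<open>The Eakin--Sathaye theorem, for the quotient of the fibre cone by the ideal that
  \<open>N\<close> determines in degree \<open>k + 1\<close>.\<close>

lemma eakin_sathaye:
  assumes I: "ideal I R" and N: "ideal N R"
    and "m \<cdot> ideal_pow R I (Suc k) \<subseteq> N" "N \<subseteq> ideal_pow R I (Suc k)"
    and "len N (ideal_pow R I (Suc k)) < enat (Suc k + s choose s)"
  shows "\<exists>y. range y \<subseteq> I \<and> span_by R y s (ideal_pow R I k) <+> N = ideal_pow R I (Suc k)"
  using assms(2-)
proof (induct "k + s" arbitrary: k s N rule: less_induct)
  case less
  note N = less.prems(1) and mN = less.prems(2) and NM = less.prems(3)
  let ?pw = "ideal_pow R I"
  note pw = ideal_pow_ideal[OF I]
  have z0: "\<zero> \<in> I" by (rule additive_subgroup.zero_closed[OF ideal.axioms(1)[OF I]])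
  have spanM: "ideal (span_by R y s (?pw k)) R \<and> span_by R y s (?pw k) \<subseteq> ?pw (Suc k)"
    if "range y \<subseteq> I" for y :: "nat \<Rightarrow> 'a" and s k
  proof
    show "ideal (span_by R y s (?pw k)) R"
      using that ideal.Icarr[OF I] by (intro span_by_ideal pw) blast
    show "span_by R y s (?pw k) \<subseteq> ?pw (Suc k)"
      using that by (intro span_by_least[OF pw]) (auto intro!: ideal_prod.prod)
  qed
  show ?case
  proof (cases "N = ?pw (Suc k)")
    case True
    have r: "range (\<lambda>_::nat. \<zero>) \<subseteq> I" using z0 by blast
    have "span_by R (\<lambda>_. \<zero>) s (?pw k) <+> N = N"
      using spanM[OF r, of s k] set_add_absorb(1)[OF _ N] True by blast
    then show ?thesis using r True by blast
  next
    case False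
    \<comment> \<open>For s = 0 the binomial is 1, so the length is 0 and \<open>N\<close> is the
      whole power, a case already settled.\<close>
    have s0: "s \<noteq> 0"
    proof
      assume "s = 0"
      then have "len N (?pw (Suc k)) < 1" using less.prems(4) by (simp add: one_enat_def)
      then show False using len_zero_iff[OF N pw NM] False by blast
    qed
    then obtain s' where s: "s = Suc s'" by (cases s) auto
    have zpw: "(\<lambda>b. z \<otimes> b) ` ?pw k \<subseteq> ?pw (Suc k)" if "z \<in> I" for z
      using that by (auto intro!: ideal_prod.prod)
    let ?N = "\<lambda>z. N <+> (\<lambda>b. z \<otimes> b) ` ?pw k"
    have zc: "z \<in> carrier R" if "z \<in> I" for z using ideal.Icarr[OF I that] .
    have zid: "ideal ((\<lambda>b. z \<otimes> b) ` ?pw k) R" if "z \<in> I" for z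
      by (rule dilate_ideal[OF zc[OF that] pw])
    have Nz: "ideal (?N z) R" "N \<subseteq> ?N z" "?N z \<subseteq> ?pw (Suc k)" if z: "z \<in> I" for z
      using add_ideals[OF N zid[OF z]] set_add_upper[OF N zid[OF z]]
        set_add_least[OF pw NM zpw[OF z]] by blast+
    show ?thesis
    \<comment> \<open>Pascal's rule splits the bound. Either some \<open>z\<close> leaves a quotient
      small enough for \<open>s'\<close> further elements in the same degree, or every colon by
      \<open>z\<close> is small enough for \<open>s\<close> elements in the degree below.\<close>
    proof (cases "\<exists>z\<in>I. len (?N z) (?pw (Suc k)) < enat (Suc k + s' choose s')")
      case True
      then obtain z where z: "z \<in> I" "len (?N z) (?pw (Suc k)) < enat (Suc k + s' choose s')"
        by blast
      have "\<exists>y. range y \<subseteq> I \<and> span_by R y s' (?pw k) <+> ?N z = ?pw (Suc k)"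
        by (rule less.hyps[OF _ Nz(1)[OF z(1)] _ Nz(3)[OF z(1)] z(2)])
          (use s mN Nz(2)[OF z(1)] in auto)
      then obtain y where y: "range y \<subseteq> I" "span_by R y s' (?pw k) <+> ?N z = ?pw (Suc k)"
        by blast
      let ?y = "y(s' := z)"
      have "span_by R ?y s' (?pw k) = span_by R y s' (?pw k)" by (rule span_by_cong) simp
      then have "span_by R ?y s (?pw k) <+> N
          = span_by R y s' (?pw k) <+> ((\<lambda>b. z \<otimes> b) ` ?pw k <+> N)"
        unfolding s
        using set_add_assoc[OF ideal_subset_carrier ideal_subset_carrier ideal_subset_carrier,
            OF conjunct1[OF spanM[OF y(1)]] zid[OF z(1)] N] by simp
      also have "\<dots> = ?pw (Suc k)"
        using set_add_comm[OF ideal_subset_carrier[OF N] ideal_subset_carrier[OF zid[OF z(1)]]] y(2)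
        by simp
      finally have "span_by R ?y s (?pw k) <+> N = ?pw (Suc k)" .
      moreover have "range ?y \<subseteq> I" using y(1) z(1) by auto
      ultimately show ?thesis by blast
    next
      case False
      let ?C = "\<lambda>z. {b \<in> ?pw k. z \<otimes> b \<in> N}"
      have Cid: "ideal (?C z) R" if "z \<in> I" for z by (rule colon_ideal_in[OF N pw zc[OF that]])
      have lenC: "len (?C z) (?pw k) < enat (k + s choose s)" if z: "z \<in> I" for z
      proof (rule ccontr)
        assume "\<not> ?thesis"
        then have "enat (k + s choose s) \<le> len N (?N z)"
          unfolding len_dilate[OF N pw zc[OF z]] by simp
        moreover have "enat (Suc k + s' choose s') \<le> len (?N z) (?pw (Suc k))"
          using False z by (simp add: not_less)
        ultimately have "enat (k + s choose s) + enat (Suc k + s' choose s') \<le> len N (?pw (Suc k))"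
          using len_add[OF N Nz(1)[OF z] pw Nz(2,3)[OF z]] by (simp only: add_mono)
        moreover have "(k + s choose s) + (Suc k + s' choose s') = (Suc k + s choose s)"
          unfolding s by simp
        ultimately have "enat (Suc k + s choose s) \<le> len N (?pw (Suc k))"
          unfolding plus_enat_simps(1) by (simp only:)
        then show False using less.prems(4) leD by blast
      qed
      show ?thesis
      proof (cases k)
        case 0
        \<comment> \<open>The bound on the colons is now \<open>s choose s\<close>, which is 1; each
          colon is the whole ring, so each \<open>z\<close> lies in \<open>N\<close>.\<close>
        have "I \<subseteq> N"
        proof
          fix z assume z: "z \<in> I"
          have "len (?C z) (?pw k) < 1" using lenC[OF z] 0 by (simp add: one_enat_def)
          then have "?C z = ?pw k" using len_zero_iff[OF Cid[OF z] pw] by blast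
          then have "\<one> \<in> ?C z" using 0 by simp
          then show "z \<in> N" using zc[OF z] by simp
        qed
        then have "N = ?pw (Suc k)" using NM 0 ideal_pow_one[OF I] by simp
        then show ?thesis using \<open>N \<noteq> ?pw (Suc k)\<close> by simp
      next
        case (Suc k')
        have mC: "m \<cdot> ?pw k \<subseteq> ?C z" if z: "z \<in> I" for z
        proof (rule ideal_prod_least[OF Cid[OF z]])
          fix u b assume u: "u \<in> m" and b: "b \<in> ?pw k"
          have uc: "u \<in> carrier R" "b \<in> carrier R"
            using ideal.Icarr[OF ideal_m u] ideal.Icarr[OF pw b] .
          have "u \<otimes> (z \<otimes> b) \<in> m \<cdot> ?pw (Suc k)"
            unfolding ideal_pow.simps by (intro ideal_prod.prod u z b)
          then have "z \<otimes> (u \<otimes> b) \<in> N" using mN uc zc[OF z] by (auto simp: m_lcomm)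
          then show "u \<otimes> b \<in> ?C z" using ideal.I_l_closed[OF pw b uc(1)] by simp
        qed
        \<comment> \<open>The sequences that the induction hypothesis provides for \<open>z\<close>.
          These sets are line-open and nonempty, so one sequence serves the finitely many generators
          \<open>Z\<close>.\<close>
        let ?U = "\<lambda>z. {y. range y \<subseteq> I \<and> span_by R y s (?pw k') <+> ?C z = ?pw k}"
        have U: "line_open I (?U z) \<and> ?U z \<subseteq> {y. range y \<subseteq> I} \<and> ?U z \<noteq> {}" if z: "z \<in> I" for z
        proof (intro conjI)
          have "len (?C z) (?pw k) < \<infinity>" using lenC[OF z] by (rule order.strict_trans) simp
          then show "line_open I (?U z)"
            using line_open_span[OF I pw[of k'] Cid[OF z], of s] mC[OF z] unfolding Suc by auto
          have "\<exists>y. range y \<subseteq> I \<and> span_by R y s (?pw k') <+> ?C z = ?pw (Suc k')"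
            by (rule less.hyps[OF _ Cid[OF z]])
              (use mC[OF z] lenC[OF z] in \<open>auto simp: Suc\<close>)
          then show "?U z \<noteq> {}" unfolding Suc by blast
        qed blast
        obtain Z where Z: "Z \<subseteq> carrier R" "finite Z" "I = Idl Z" using finetely_gen[OF I] by blast
        have ZI: "Z \<subseteq> I" using genideal_self[OF Z(1)] Z(3) by simp
        obtain y where y: "range y \<subseteq> I" "\<forall>z\<in>Z. y \<in> ?U z"
          using line_open_finite_meet[OF I Z(2), of ?U] U ZI by blast
        let ?D = "span_by R y s (?pw k) <+> N"
        have sp: "ideal (span_by R y s (?pw k)) R" "span_by R y s (?pw k) \<subseteq> ?pw (Suc k)"
          using spanM[OF y(1)] by blast+
        have D: "ideal ?D R" by (rule add_ideals[OF sp(1) N])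
        have "?pw (Suc k) \<subseteq> ?D"
          unfolding ideal_pow.simps(2)[of R I k]
        proof (rule ideal_prod_least[OF D])
          fix a b assume a: "a \<in> I" and b: "b \<in> ?pw k"
          have bc: "b \<in> carrier R" by (rule ideal.Icarr[OF pw b])
          \<comment> \<open>Split b = p + q according to the condition at \<open>z\<close>: then z p
            lies in the span one degree higher, and z q in \<open>N\<close> by definition of the
            colon.\<close>
          have "Z \<subseteq> {a \<in> carrier R. a \<otimes> b \<in> ?D}"
          proof
            fix z assume z: "z \<in> Z"
            then have zI: "z \<in> I" using ZI by blast
            have "span_by R y s (?pw k') <+> ?C z = ?pw k" using y(2) z by blast
            then have "b \<in> span_by R y s (?pw k') <+> ?C z" using b by (simp only:)
            then obtain p q where pq: "p \<in> span_by R y s (?pw k')" "q \<in> ?C z" "b = p \<oplus> q"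
              unfolding set_add_iff by blast
            have "p \<in> carrier R" "q \<in> carrier R"
              using ideal.Icarr[OF conjunct1[OF spanM[OF y(1)]] pq(1)] ideal.Icarr[OF Cid[OF zI] pq(2)] .
            then have "z \<otimes> b = z \<otimes> p \<oplus> z \<otimes> q" using pq(3) zc[OF zI] by (simp add: r_distr)
            moreover have "z \<otimes> p \<in> span_by R y s (?pw k)"
              unfolding Suc ideal_pow.simps
              by (rule span_by_mult_mem[OF I pw _ zI pq(1)]) (use y(1) zc in auto)
            ultimately have "z \<otimes> b \<in> ?D" unfolding set_add_iff using pq(2) by blast
            then show "z \<in> {a \<in> carrier R. a \<otimes> b \<in> ?D}" using zc[OF zI] by simp
          qed
          then have "Idl Z \<subseteq> {a \<in> carrier R. a \<otimes> b \<in> ?D}"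
            by (rule genideal_minimal[OF colon_ideal[OF D bc]])
          then show "a \<otimes> b \<in> ?D" using a Z(3) by blast
        qed
        moreover have "?D \<subseteq> ?pw (Suc k)" by (rule set_add_least[OF pw sp(2) NM])
        ultimately show ?thesis using y(1) by blast
      qed
    qed
  qed
qed

text \<open>\<open>eakin_sathaye\<close> is applied with N = m I^(k+1), where the length is bounded
  by \<open>len_power_fibre\<close> and \<open>binomial_bound\<close>; Nakayama's lemma then removes
  the summand \<open>N\<close>.\<close>

lemma reduction_of_generators:
  assumes I: "ideal I R" "I \<subseteq> m" and x: "\<forall>i<Suc p. x i \<in> I"
    and prim: "ideal_pow R m c \<subseteq> I"
    and e: "len (gen_by R x (Suc p)) (carrier R) = enat e"
    and k: "Suc p * e < k + 2 * Suc p"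
  shows "\<exists>y. range y \<subseteq> I \<and> ideal_pow R I (Suc k) = gen_by R y (Suc p) \<cdot> ideal_pow R I k"
proof -
  let ?a = "ideal_pow R I (Suc k)"
  note pw = ideal_pow_ideal[OF I(1)]
  have ma: "ideal (m \<cdot> ?a) R" "m \<cdot> ?a \<subseteq> ?a"
    using ideal_prod_is_ideal[OF ideal_m pw] ideal_prod_inter[OF ideal_m pw] by blast+
  have "len (m \<cdot> ?a) ?a \<le> enat (k + p choose k) * enat e + enat (k + p choose Suc k)"
    using len_power_fibre[OF I x prim, of k] unfolding e .
  also have "\<dots> = enat (e * (k + p choose k) + (k + p choose Suc k))" by (simp add: mult.commute)
  also have "\<dots> < enat (Suc k + Suc p choose Suc p)"
    using binomial_bound[OF k] by (simp only: enat_ord_simps)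
  finally obtain y where y: "range y \<subseteq> I"
    "span_by R y (Suc p) (ideal_pow R I k) <+> m \<cdot> ?a = ?a"
    using eakin_sathaye[OF I(1) ma(1) subset_refl ma(2), of "Suc p"] by blast
  have yc: "i < Suc p \<Longrightarrow> y i \<in> carrier R" for i using y(1) ideal_subset_carrier[OF I(1)] by blast
  have sp: "ideal (span_by R y (Suc p) (ideal_pow R I k)) R" by (rule span_by_ideal[OF yc pw])
  have "?a \<subseteq> span_by R y (Suc p) (ideal_pow R I k)"
    by (rule nakayama[OF pw sp]) (simp only: y(2) order_refl)
  moreover have "span_by R y (Suc p) (ideal_pow R I k) \<subseteq> ?a"
    using set_add_upper(1)[OF sp ma(1)] unfolding y(2) .
  ultimately have "?a = span_by R y (Suc p) (ideal_pow R I k)" by (rule subset_antisym)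
  also have "\<dots> = gen_by R y (Suc p) \<cdot> ideal_pow R I k" by (rule span_by_eq_prod[OF yc pw])
  finally show ?thesis using y(1) by blast
qed

end

section \<open>Systems of parameters and minimal reductions\<close>

context noetherian_local_ring
begin

lemma prime_product_below:
  assumes "ideal A R"
  shows "\<exists>F. finite F \<and> (\<forall>P\<in>F. primeideal P R \<and> A \<subseteq> P) \<and>
    (\<forall>P. primeideal P R \<longrightarrow> A \<subseteq> P \<longrightarrow> (\<exists>Q\<in>F. Q \<subseteq> P)) \<and>
    (F \<subseteq> {m} \<longrightarrow> (\<exists>k. ideal_pow R m k \<subseteq> A))"
    (is "?good A")
proof (rule ccontr)
  assume "\<not> ?good A"
  then have "{A. ideal A R \<and> \<not> ?good A} \<noteq> {}" using assms by blast
  then obtain M where M: "M \<in> {A. ideal A R \<and> \<not> ?good A}"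
    and max: "\<And>C. C \<in> {A. ideal A R \<and> \<not> ?good A} \<Longrightarrow> M \<subseteq> C \<Longrightarrow> C = M"
    by (rule exists_maximal_ideal_in) simp_all
  have idM: "ideal M R" and bad: "\<not> ?good M" using M by simp_all
  have "M \<noteq> carrier R"
  proof
    assume eq: "M = carrier R"
    have "\<not> carrier R \<subseteq> P" if "primeideal P R" for P
      using primeideal.I_notcarr[OF that] ideal_subset_carrier[OF primeideal.axioms(1)[OF that]]
      by auto
    \<comment> \<open>No prime contains the unit ideal, and the zeroth power of \<open>m\<close> is
      the ring.\<close>
    then have "?good M" unfolding eq
      by (intro exI[of _ "{}"]) (auto intro: exI[of _ 0])
    then show False using bad by simp
  qed
  moreover have "\<not> primeideal M R"
  proof
    assume p: "primeideal M R"
    have "\<exists>k. ideal_pow R m k \<subseteq> M" if "M = m"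
      using ideal_pow_one[OF ideal_m] that by (intro exI[of _ "Suc 0"]) simp
    then have "?good M" by (intro exI[of _ "{M}"]) (use p in auto)
    then show False using bad by simp
  qed
  ultimately obtain a b where ab: "a \<in> carrier R" "b \<in> carrier R" "a \<otimes> b \<in> M" "a \<notin> M" "b \<notin> M"
    using ideal.primeidealCE[OF idM is_cring] by metis
  let ?A = "M <+> (\<lambda>r. a \<otimes> r) ` carrier R" and ?B = "M <+> (\<lambda>r. b \<otimes> r) ` carrier R"
  have good: "?good (M <+> (\<lambda>r. x \<otimes> r) ` carrier R)" and Mx: "M \<subseteq> M <+> (\<lambda>r. x \<otimes> r) ` carrier R"
    and idx: "ideal (M <+> (\<lambda>r. x \<otimes> r) ` carrier R) R"
    if x: "x \<in> carrier R" "x \<notin> M" for x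
  proof -
    let ?X = "M <+> (\<lambda>r. x \<otimes> r) ` carrier R"
    have P: "ideal ((\<lambda>r. x \<otimes> r) ` carrier R) R" by (rule dilate_ideal[OF x(1) oneideal])
    show X: "ideal ?X R" "M \<subseteq> ?X"
      by (intro add_ideals set_add_upper idM P)+
    have "x \<in> (\<lambda>r. x \<otimes> r) ` carrier R" using x by (intro image_eqI[of _ _ "\<one>"]) simp_all
    then have "?X \<noteq> M" using set_add_upper(2)[OF idM P] x(2) by blast
    then show "?good ?X" using max[of ?X] X by blast
  qed
  have AB: "?A \<cdot> ?B \<subseteq> M"
  proof (rule ideal_prod_least[OF idM])
    interpret M: ideal M R by (rule idM)
    fix u v assume "u \<in> ?A" "v \<in> ?B"
    then obtain p r q s where pq: "p \<in> M" "r \<in> carrier R" "u = p \<oplus> a \<otimes> r"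
        "q \<in> M" "s \<in> carrier R" "v = q \<oplus> b \<otimes> s"
      unfolding set_add_iff by blast
    have c: "p \<in> carrier R" "q \<in> carrier R" using M.Icarr[OF pq(1)] M.Icarr[OF pq(4)] .
    have "u \<otimes> v = (q \<oplus> b \<otimes> s) \<otimes> p \<oplus> (a \<otimes> r) \<otimes> q \<oplus> (r \<otimes> s) \<otimes> (a \<otimes> b)"
      unfolding pq(3,6) using c pq(2,5) ab(1,2) by algebra
    moreover have "\<dots> \<in> M"
      using M.I_l_closed[OF ab(3) m_closed[OF pq(2,5)]] c pq ab(1,2)
      by (intro M.a_closed M.I_l_closed[OF pq(1)] M.I_l_closed[OF pq(4)]) simp_all
    ultimately show "u \<otimes> v \<in> M" by simp
  qed
  obtain F where F: "finite F" "\<forall>P\<in>F. primeideal P R \<and> ?A \<subseteq> P"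
    "\<forall>P. primeideal P R \<longrightarrow> ?A \<subseteq> P \<longrightarrow> (\<exists>Q\<in>F. Q \<subseteq> P)"
    "F \<subseteq> {m} \<longrightarrow> (\<exists>k. ideal_pow R m k \<subseteq> ?A)"
    using good[OF ab(1,4)] by blast
  obtain G where G: "finite G" "\<forall>P\<in>G. primeideal P R \<and> ?B \<subseteq> P"
    "\<forall>P. primeideal P R \<longrightarrow> ?B \<subseteq> P \<longrightarrow> (\<exists>Q\<in>G. Q \<subseteq> P)"
    "G \<subseteq> {m} \<longrightarrow> (\<exists>k. ideal_pow R m k \<subseteq> ?B)"
    using good[OF ab(2,5)] by blast
  have "?good M"
  proof (intro exI[of _ "F \<union> G"] conjI)
    show "finite (F \<union> G)" using F G by simp
    show "\<forall>P\<in>F \<union> G. primeideal P R \<and> M \<subseteq> P"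
      using F(2) G(2) Mx[OF ab(1,4)] Mx[OF ab(2,5)] by blast
    show "\<forall>P. primeideal P R \<longrightarrow> M \<subseteq> P \<longrightarrow> (\<exists>Q\<in>F \<union> G. Q \<subseteq> P)"
    proof (intro allI impI)
      fix P assume P: "primeideal P R" "M \<subseteq> P"
      have "?A \<subseteq> P \<or> ?B \<subseteq> P"
        using primeideal_divides_ideal_prod[OF P(1) idx[OF ab(1,4)] idx[OF ab(2,5)]] AB P(2) by blast
      then show "\<exists>Q\<in>F \<union> G. Q \<subseteq> P" using F(3) G(3) P(1) by blast
    qed
    show "F \<union> G \<subseteq> {m} \<longrightarrow> (\<exists>k. ideal_pow R m k \<subseteq> M)"
    proof
      assume "F \<union> G \<subseteq> {m}"
      then obtain i j where "ideal_pow R m i \<subseteq> ?A" "ideal_pow R m j \<subseteq> ?B" using F(4) G(4) by blast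
      then have "ideal_pow R m (i + j) \<subseteq> M"
        using ideal_prod_mono[of "ideal_pow R m i" ?A "ideal_pow R m j" ?B] AB
        unfolding ideal_pow_add[OF ideal_m] by blast
      then show "\<exists>k. ideal_pow R m k \<subseteq> M" by blast
    qed
  qed
  then show False using bad by simp
qed

text \<open>Some m-primary ideal has \<open>s\<close> generators; for s = 0 this says that
  \<open>m\<close> is nilpotent.\<close>

definition primary_gens :: "nat \<Rightarrow> bool" where
  "primary_gens s \<longleftrightarrow> (\<exists>x. (\<forall>i<s. x i \<in> m) \<and> (\<exists>c. ideal_pow R m c \<subseteq> gen_by R x s))"

text \<open>The height of the prime \<open>P\<close> is at least \<open>n\<close>.\<close>

definition prime_chain_to :: "nat \<Rightarrow> 'a set \<Rightarrow> bool" where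
  "prime_chain_to n P \<longleftrightarrow> (\<exists>C :: nat \<Rightarrow> 'a set.
     (\<forall>i\<le>n. primeideal (C i) R) \<and> (\<forall>i<n. C i \<subset> C (Suc i)) \<and> C n = P)"

lemma prime_chain_to_Suc:
  assumes "prime_chain_to n P" "P \<subset> Q" "primeideal Q R"
  shows "prime_chain_to (Suc n) Q"
proof -
  obtain C :: "nat \<Rightarrow> 'a set" where C: "\<forall>i\<le>n. primeideal (C i) R" "\<forall>i<n. C i \<subset> C (Suc i)" "C n = P"
    using assms(1) unfolding prime_chain_to_def by blast
  show ?thesis
    unfolding prime_chain_to_def
    by (rule exI[of _ "C(Suc n := Q)"]) (use C assms(2,3) in \<open>auto simp: le_Suc_eq less_Suc_eq\<close>)
qed

lemma prime_chain_to_le_krull_dim: "prime_chain_to n P \<Longrightarrow> enat n \<le> krull_dim R"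
  unfolding prime_chain_to_def krull_dim_def by (rule Sup_upper) blast

text \<open>Let Q be the given ideal. If a reduction Q' were strictly smaller, Nakayama's lemma
  would make Q' + m Q proper in Q, so fewer than \<open>s\<close> elements of Q' would span it
  modulo m Q. The ideal L of these elements satisfies I^(r+1) \<subseteq> L I^r + m I^(r+1), and
  Nakayama's lemma again puts I^(r+1) into L.\<close>

lemma primary_reduction_minimal:
  assumes I: "ideal I R" "I \<subseteq> m" and prim: "ideal_pow R m c \<subseteq> I"
    and y: "\<forall>i<s. y i \<in> I" and min: "\<And>l. l < s \<Longrightarrow> \<not> primary_gens l"
    and Q: "is_reduction R (gen_by R y s) I"
  shows "is_minimal_reduction R (gen_by R y s) I"
  unfolding is_minimal_reduction_def
proof (intro conjI allI impI Q)
  fix Q' assume "is_reduction R Q' I \<and> Q' \<subseteq> gen_by R y s"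
  then have Q': "ideal Q' R" "Q' \<subseteq> gen_by R y s" and "\<exists>r. ideal_pow R I (Suc r) = Q' \<cdot> ideal_pow R I r"
    unfolding is_reduction_def by blast+
  then obtain r where r: "ideal_pow R I (Suc r) = Q' \<cdot> ideal_pow R I r" by blast
  let ?Q = "gen_by R y s"
  have idQ: "ideal ?Q R" "?Q \<subseteq> I" using Q unfolding is_reduction_def by blast+
  note pw = ideal_pow_ideal[OF I(1)]
  have mQ: "ideal (m \<cdot> ?Q) R" "m \<cdot> ?Q \<subseteq> ?Q"
    using ideal_prod_is_ideal[OF ideal_m idQ(1)] ideal_prod_inter[OF ideal_m idQ(1)] by blast+
  let ?B = "m \<cdot> ?Q <+> Q'"
  have B: "ideal ?B R" by (rule add_ideals[OF mQ(1) Q'(1)])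
  have BQ: "?B \<subseteq> ?Q" by (rule set_add_least[OF idQ(1) mQ(2) Q'(2)])
  have mB: "m \<cdot> ?Q \<subseteq> ?B" "Q' \<subseteq> ?B" by (rule set_add_upper[OF mQ(1) Q'(1)])+
  have "?Q \<subseteq> Q'"
  proof (rule nakayama[OF idQ(1) Q'(1)], rule ccontr)
    assume n: "\<not> ?Q \<subseteq> Q' <+> m \<cdot> ?Q"
    have comm: "Q' <+> m \<cdot> ?Q = ?B"
      by (rule set_add_comm[OF ideal_subset_carrier[OF Q'(1)] ideal_subset_carrier[OF mQ(1)]])
    \<comment> \<open>\<open>len_add_power\<close> in degree one, where the binomial is
      \<open>s\<close>: the length of Q / m Q is at most the number of generators.\<close>
    have "len (m \<cdot> ?Q) (m \<cdot> ?Q <+> ideal_pow R ?Q (Suc 0))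
        \<le> enat (Suc 0 + s - 1 choose Suc 0) * len m (carrier R)"
      by (rule len_add_power[OF ideal_m mQ(1)])
        (use y ideal_subset_carrier[OF I(1)] ideal_pow_one[OF idQ(1)] in auto)
    then have "len (m \<cdot> ?Q) ?Q \<le> enat s"
      using set_add_absorb(1)[OF mQ(1) idQ(1) mQ(2)] ideal_pow_one[OF idQ(1)] len_m
      by (simp add: ideal_pow_one[OF idQ(1)])
    moreover have "1 \<le> len ?B ?Q"
      by (rule len_pos[OF B idQ(1)]) (use n BQ comm in auto)
    moreover have "len (m \<cdot> ?Q) ?Q = len (m \<cdot> ?Q) ?B + len ?B ?Q"
      by (rule len_add[OF mQ(1) B idQ(1) mB(1) BQ])
    ultimately obtain l where l: "len (m \<cdot> ?Q) ?B = enat l" "l < s"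
      by (cases "len (m \<cdot> ?Q) ?B"; cases "len ?B ?Q") (auto simp: one_enat_def)
    then obtain z where z: "\<forall>i<l. z i \<in> Q'" "?B = m \<cdot> ?Q <+> gen_by R z l"
      using greedy_generators[OF mQ(1) Q'(1), of l] by auto
    let ?L = "gen_by R z l"
    have zm: "\<forall>i<l. z i \<in> m" using z(1) Q'(2) idQ(2) I(2) by blast
    have L: "ideal ?L R"
      by (rule span_by_ideal[OF _ oneideal]) (use zm ideal_subset_carrier[OF ideal_m] in blast)
    have LQ: "?L \<subseteq> ?Q" using set_add_upper(2)[OF mQ(1) L] z(2) BQ by blast
    have "ideal_pow R I (Suc r) \<subseteq> (m \<cdot> ?Q <+> ?L) \<cdot> ideal_pow R I r"
      unfolding r using mB(2) z(2) by (intro ideal_prod_mono) simp_all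
    also have "\<dots> = m \<cdot> ?Q \<cdot> ideal_pow R I r <+> ?L \<cdot> ideal_pow R I r"
      by (rule ideal_prod_distr(2)[OF pw mQ(1) L])
    also have "\<dots> \<subseteq> ?L \<cdot> ideal_pow R I r <+> m \<cdot> ideal_pow R I (Suc r)"
    proof -
      have "?Q \<cdot> ideal_pow R I r \<subseteq> ideal_pow R I (Suc r)"
        unfolding ideal_pow.simps by (rule ideal_prod_mono[OF idQ(2) subset_refl])
      then have "m \<cdot> ?Q \<cdot> ideal_pow R I r \<subseteq> m \<cdot> ideal_pow R I (Suc r)"
        unfolding ideal_prod_assoc[OF ideal_m idQ(1) pw] by (rule ideal_prod_mono[OF subset_refl])
      then show ?thesis
        using set_add_upper[OF ideal_prod_is_ideal[OF L pw[of r]] ideal_prod_is_ideal[OF ideal_m pw[of "Suc r"]]]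
        by (intro set_add_least[OF add_ideals[OF ideal_prod_is_ideal[OF L pw] ideal_prod_is_ideal[OF ideal_m pw]]])
          blast+
    qed
    finally have "ideal_pow R I (Suc r) \<subseteq> ?L \<cdot> ideal_pow R I r"
      by (rule nakayama[OF pw ideal_prod_is_ideal[OF L pw]])
    also have "\<dots> \<subseteq> ?L" using ideal_prod_inter[OF L pw] by blast
    finally have IL: "ideal_pow R I (Suc r) \<subseteq> ?L" .
    have "ideal_pow R m (c * Suc r) \<subseteq> ideal_pow R I (Suc r)"
      by (rule ideal_pow_mono[OF prim, of "Suc r", unfolded ideal_pow_mult[OF ideal_m]])
    then have "ideal_pow R m (c * Suc r) \<subseteq> ?L" using IL by (rule order_trans)
    then have "primary_gens l" unfolding primary_gens_def using zm by blast
    then show False using min[OF l(2)] by simp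
  qed
  then show "Q' = ?Q" using Q'(2) by (rule subset_antisym[rotated])
qed

end

section \<open>Systems of parameters and the bound on the reduction number\<close>

context noetherian_local_ring_inf
begin

text \<open>Avoidance of arbitrary ideals, by the infinite residue field: the complement of each
  ideal is line-open. Only the entry \<open>y 0\<close> of the sequences is of interest.\<close>

lemma avoid_ideals:
  assumes "finite F" "\<And>P. P \<in> F \<Longrightarrow> ideal P R \<and> \<not> m \<subseteq> P"
  shows "\<exists>x\<in>m. \<forall>P\<in>F. x \<notin> P"
proof -
  let ?U = "\<lambda>P. {y :: nat \<Rightarrow> 'a. range y \<subseteq> m \<and> y 0 \<notin> P}"
  have "\<exists>y. range y \<subseteq> m \<and> (\<forall>P\<in>F. y \<in> ?U P)"
  proof (rule line_open_finite_meet[OF ideal_m assms(1)])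
    fix P assume "P \<in> F"
    then have P: "ideal P R" and nP: "\<not> m \<subseteq> P" using assms(2) by blast+
    obtain x where x: "x \<in> m" "x \<notin> P" using nP by blast
    have "(\<lambda>_. x) \<in> ?U P" using x by auto
    moreover have "line_open m (?U P)"
      unfolding line_open_def
    proof (intro ballI allI impI)
      fix y v :: "nat \<Rightarrow> 'a" assume y: "y \<in> ?U P" and v: "range v \<subseteq> m"
      let ?Bad = "{t \<in> carrier R. (\<lambda>i. y i \<oplus> t \<otimes> v i) \<notin> ?U P}"
      have c: "y i \<in> carrier R" "v i \<in> carrier R" "y i \<in> m" "v i \<in> m" for i
        using y v ideal_subset_carrier[OF ideal_m] by blast+
      have bad: "y 0 \<oplus> t \<otimes> v 0 \<in> P \<and> t \<in> carrier R" if "t \<in> ?Bad" for t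
      proof -
        have t: "t \<in> carrier R" using that by blast
        have "y i \<oplus> t \<otimes> v i \<in> m" for i
          by (intro additive_subgroup.a_closed[OF ideal.axioms(1)[OF ideal_m]]
              ideal.I_l_closed[OF ideal_m] c t)
        then show ?thesis using that by blast
      qed
      \<comment> \<open>Two bad parameters that differ by a unit would put \<open>v 0\<close>, and
        hence \<open>y 0\<close>, into \<open>P\<close>; the bad parameters lie in one residue
        class.\<close>
      have diff: "t \<ominus> u \<in> m" if t: "t \<in> ?Bad" and u: "u \<in> ?Bad" for t u
      proof (rule ccontr)
        assume n: "t \<ominus> u \<notin> m"
        have tc: "t \<in> carrier R" "u \<in> carrier R" using bad[OF t] bad[OF u] by simp_all
        have cl: "a \<ominus> b \<in> P" if "a \<in> P" "b \<in> P" for a b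
          unfolding minus_eq using that
          by (intro additive_subgroup.a_closed[OF ideal.axioms(1)[OF P]]
              additive_subgroup.a_inv_closed[OF ideal.axioms(1)[OF P]])
        have "(y 0 \<oplus> t \<otimes> v 0) \<ominus> (y 0 \<oplus> u \<otimes> v 0) \<in> P"
          using bad[OF t] bad[OF u] by (intro cl) simp_all
        moreover have "(y 0 \<oplus> t \<otimes> v 0) \<ominus> (y 0 \<oplus> u \<otimes> v 0) = (t \<ominus> u) \<otimes> v 0"
          using c(1,2)[of 0] tc by algebra
        ultimately have "v 0 \<in> P" using unit_cancel[OF P minus_closed[OF tc] n c(2)] by simp
        then have "t \<otimes> v 0 \<in> P" by (rule ideal.I_l_closed[OF P _ tc(1)])
        then have "(y 0 \<oplus> t \<otimes> v 0) \<ominus> t \<otimes> v 0 \<in> P" using bad[OF t] by (intro cl) simp_all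
        moreover have "(y 0 \<oplus> t \<otimes> v 0) \<ominus> t \<otimes> v 0 = y 0" using c(1,2)[of 0] tc by algebra
        ultimately show False using y by simp
      qed
      show "finite_mod ?Bad"
      proof (cases "?Bad = {}")
        case True
        show ?thesis unfolding finite_mod_def True by (rule exI[of _ "{}"]) simp
      next
        case False
        then obtain u where u: "u \<in> ?Bad" by blast
        then show ?thesis
          unfolding finite_mod_def using diff[OF _ u] bad[OF u] by (intro exI[of _ "{u}"]) blast
      qed
    qed
    ultimately show "line_open m (?U P) \<and> ?U P \<subseteq> {y. range y \<subseteq> m} \<and> ?U P \<noteq> {}" by blast
  qed
  then obtain y :: "nat \<Rightarrow> 'a" where "range y \<subseteq> m" "\<forall>P\<in>F. y \<in> ?U P" by blast
  then show ?thesis by (intro bexI[of _ "y 0"]) auto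
qed

text \<open>While no m-primary ideal has n generators, the finite family of primes over the first n
  elements has a member other than \<open>m\<close>, and the next element is chosen in
  \<open>m\<close> outside all such members. Every prime over the longer list then strictly contains
  a member of the family, so heights grow with the list and \<open>m\<close> would have height at
  least d + 1.\<close>

lemma exists_system_of_parameters:
  assumes "krull_dim R = enat d"
  shows "\<exists>s\<le>d. primary_gens s"
proof (rule ccontr)
  assume none: "\<not> ?thesis"
  have "\<exists>x. (\<forall>i<n. x i \<in> m) \<and>
      (\<forall>P. primeideal P R \<longrightarrow> gen_by R x n \<subseteq> P \<longrightarrow> prime_chain_to n P)" if "n \<le> Suc d" for n
    using that
  proof (induct n)
    case 0
    have "prime_chain_to 0 P" if "primeideal P R" for P
      unfolding prime_chain_to_def using that by (intro exI[of _ "\<lambda>_. P"]) simp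
    then show ?case by simp
  next
    case (Suc n)
    then obtain x where x: "\<forall>i<n. x i \<in> m"
      and chain: "\<And>P. primeideal P R \<Longrightarrow> gen_by R x n \<subseteq> P \<Longrightarrow> prime_chain_to n P" by auto
    have xc: "i < n \<Longrightarrow> x i \<in> carrier R" for i using x ideal_subset_carrier[OF ideal_m] by blast
    let ?A = "gen_by R x n"
    have A: "ideal ?A R" by (rule span_by_ideal[OF xc oneideal])
    have Am: "?A \<subseteq> m" by (rule gen_by_least[OF ideal_m]) (use x in simp)
    obtain F where F: "finite F" "\<forall>P\<in>F. primeideal P R \<and> ?A \<subseteq> P"
      "\<forall>P. primeideal P R \<longrightarrow> ?A \<subseteq> P \<longrightarrow> (\<exists>Q\<in>F. Q \<subseteq> P)"
      "F \<subseteq> {m} \<longrightarrow> (\<exists>k. ideal_pow R m k \<subseteq> ?A)"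
      using prime_product_below[OF A] by blast
    have "\<not> primary_gens n" using none Suc.prems by simp
    then have "\<not> F \<subseteq> {m}" using F(4) x unfolding primary_gens_def by blast
    then obtain P0 where P0: "P0 \<in> F" "P0 \<noteq> m" by blast
    have Fm: "P \<subseteq> m" "ideal P R" if "P \<in> F" for P
    proof -
      have p: "primeideal P R" using F(2) that by blast
      show "ideal P R" by (rule primeideal.axioms(1)[OF p])
      then show "P \<subseteq> m" using proper_subset_m primeideal.I_notcarr[OF p] by metis
    qed
    have "\<exists>z\<in>m. \<forall>P\<in>F - {m}. z \<notin> P"
    proof (rule avoid_ideals)
      show "finite (F - {m})" using F(1) by simp
      show "ideal P R \<and> \<not> m \<subseteq> P" if "P \<in> F - {m}" for P
        using Fm[of P] that by blast
    qed
    then obtain z where z: "z \<in> m" "\<forall>P\<in>F - {m}. z \<notin> P" by blast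
    let ?x = "x(n := z)"
    have zc: "z \<in> carrier R" using ideal.Icarr[OF ideal_m z(1)] .
    have gx: "gen_by R ?x (Suc n) = ?A <+> (\<lambda>r. z \<otimes> r) ` carrier R"
    proof -
      have "gen_by R ?x n = ?A" by (rule span_by_cong) simp
      then show ?thesis by simp
    qed
    have Z: "ideal ((\<lambda>r. z \<otimes> r) ` carrier R) R" by (rule dilate_ideal[OF zc oneideal])
    have zin: "z \<in> (\<lambda>r. z \<otimes> r) ` carrier R" using zc by (intro image_eqI[of _ _ "\<one>"]) simp_all
    have "prime_chain_to (Suc n) P" if P: "primeideal P R" "gen_by R ?x (Suc n) \<subseteq> P" for P
    proof -
      have AP: "?A \<subseteq> P" and zP: "z \<in> P"
        using P(2) set_add_upper[OF A Z] zin unfolding gx by blast+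
      obtain Q where Q: "Q \<in> F" "Q \<subseteq> P" using F(3) P(1) AP by blast
      have Pm: "P \<subseteq> m"
        using proper_subset_m[OF primeideal.axioms(1)[OF P(1)]] primeideal.I_notcarr[OF P(1)] by metis
      \<comment> \<open>If the member found below \<open>P\<close> is \<open>m\<close> itself, then
        \<open>P = m\<close> and \<open>P0\<close> lies strictly below it.\<close>
      have "\<exists>Q\<in>F. Q \<subset> P"
      proof (cases "Q = m")
        case True
        then show ?thesis using Q Pm P0 Fm(1)[OF P0(1)] by blast
      next
        case False
        then show ?thesis using Q z(2) zP by blast
      qed
      then obtain Q where "Q \<in> F" "Q \<subset> P" by blast
      then show ?thesis using prime_chain_to_Suc[OF chain _ P(1)] F(2) by blast
    qed
    moreover have "\<forall>i<Suc n. ?x i \<in> m" using x z(1) by (simp add: less_Suc_eq)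
    ultimately show ?case by blast
  qed
  from this[OF order_refl] obtain x where x: "\<forall>i<Suc d. x i \<in> m"
    "\<forall>P. primeideal P R \<longrightarrow> gen_by R x (Suc d) \<subseteq> P \<longrightarrow> prime_chain_to (Suc d) P" by blast
  have "gen_by R x (Suc d) \<subseteq> m" by (rule gen_by_least[OF ideal_m]) (use x in simp)
  then have "prime_chain_to (Suc d) m" using x(2) primeideal_m by blast
  then show False using prime_chain_to_le_krull_dim assms by fastforce
qed

text \<open>If \<open>m\<close> is nilpotent, every prime contains \<open>m\<close>, so the
  dimension is 0.\<close>

lemma not_primary_gens_0:
  assumes "krull_dim R = enat d" "d \<ge> 1"
  shows "\<not> primary_gens 0"
proof
  assume "primary_gens 0"
  then obtain c where c: "ideal_pow R m c \<subseteq> {\<zero>}" unfolding primary_gens_def by auto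
  have only: "P = m" if P: "primeideal P R" for P
  proof
    have idP: "ideal P R" by (rule primeideal.axioms(1)[OF P])
    show "P \<subseteq> m" using proper_subset_m[OF idP] primeideal.I_notcarr[OF P] by metis
    have "ideal_pow R m c \<subseteq> P"
      using c additive_subgroup.zero_closed[OF ideal.axioms(1)[OF idP]] by blast
    then show "m \<subseteq> P" by (rule prime_contains_power[OF P ideal_m])
  qed
  have "krull_dim R \<le> 0"
    unfolding krull_dim_def
  proof (rule Sup_least)
    fix a assume "a \<in> {enat n | n. \<exists>P :: nat \<Rightarrow> 'a set.
      (\<forall>i\<le>n. primeideal (P i) R) \<and> (\<forall>i<n. P i \<subset> P (Suc i))}"
    then obtain n and P :: "nat \<Rightarrow> 'a set" where n: "a = enat n"
      "\<forall>i\<le>n. primeideal (P i) R" "\<forall>i<n. P i \<subset> P (Suc i)" by blast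
    have "n = 0"
    proof (rule ccontr)
      assume "n \<noteq> 0"
      then have "P 0 \<subset> P (Suc 0)" "P 0 = m" "P (Suc 0) = m" using n only by simp_all
      then show False by simp
    qed
    then show "a \<le> 0" using n by (simp add: zero_enat_def)
  qed
  then show False using assms by (simp add: zero_enat_def)
qed

text \<open>Powers of the given parameters lie in \<open>J\<close> and still generate an ideal of
  finite colength, which is what \<open>reduction_of_generators\<close> asks for.\<close>

lemma minimal_reduction_generators:
  assumes J: "ideal J R" "J \<subseteq> m" and prim: "ideal_pow R m c \<subseteq> J" and s: "primary_gens (Suc p)"
  shows "\<exists>y. (\<forall>i<Suc p. y i \<in> J) \<and> is_reduction R (gen_by R y (Suc p)) J"
proof -
  obtain x b where x: "\<forall>i<Suc p. x i \<in> m" "ideal_pow R m b \<subseteq> gen_by R x (Suc p)"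
    using s unfolding primary_gens_def by blast
  let ?x = "\<lambda>i. x i [^] c"
  have xc: "\<forall>i<Suc p. x i \<in> carrier R" using x(1) ideal_subset_carrier[OF ideal_m] by blast
  have xJ: "\<forall>i<Suc p. ?x i \<in> J"
  proof (intro allI impI)
    fix i assume "i < Suc p"
    then have "x i \<in> m" using x(1) by simp
    then show "?x i \<in> J" using pow_mem_ideal_pow[OF _ ideal_m, of "x i" c] prim by blast
  qed
  have xc': "i < Suc p \<Longrightarrow> ?x i \<in> carrier R" for i using xc by simp
  let ?q = "gen_by R ?x (Suc p)"
  have q: "ideal ?q R" by (rule span_by_ideal[OF xc' oneideal])
  have "\<exists>n. ideal_pow R (gen_by R x (Suc p)) n \<subseteq> ?q"
  proof (rule gen_by_power_subset[OF q xc])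
    show "\<forall>i<Suc p. \<exists>n::nat. x i [^] n \<in> ?q"
      by (intro allI impI, rule exI[of _ c], rule gen_by_upper[of "Suc p" ?x, OF xc'])
  qed
  then obtain n where n: "ideal_pow R (gen_by R x (Suc p)) n \<subseteq> ?q" by blast
  have "ideal_pow R m (b * n) \<subseteq> ?q"
    using ideal_pow_mono[OF x(2), of n, unfolded ideal_pow_mult[OF ideal_m]] n by (rule order_trans)
  then obtain e where e: "len ?q (carrier R) = enat e"
    using len_finite[OF q] by (cases "len ?q (carrier R)") auto
  \<comment> \<open>A reduction only needs some exponent, so a crude one is taken.\<close>
  have "Suc p * e < Suc p * e + 2 * Suc p" by simp
  then obtain y where y: "range y \<subseteq> J"
    "ideal_pow R J (Suc (Suc p * e)) = gen_by R y (Suc p) \<cdot> ideal_pow R J (Suc p * e)"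
    using reduction_of_generators[OF J xJ prim e] by blast
  have "gen_by R y (Suc p) \<subseteq> J" by (rule gen_by_least[OF J(1)]) (use y(1) in blast)
  moreover have "ideal (gen_by R y (Suc p)) R"
    by (rule span_by_ideal[OF _ oneideal]) (use y(1) ideal_subset_carrier[OF J(1)] in blast)
  ultimately have "is_reduction R (gen_by R y (Suc p)) J"
    unfolding is_reduction_def using y(2) by blast
  then show ?thesis using y(1) by blast
qed

lemma exists_minimal_reduction_bound:
  assumes dim: "krull_dim R = enat d" "d \<ge> 1" and I: "primary_to R m I"
    and J: "is_minimal_reduction R J I"
  shows "\<exists>Q. is_minimal_reduction R Q I \<and>
    int (reduction_number R Q I) \<le> max (int d * int (the_enat (quot_length R J)) - 2 * int d + 1) 0"
proof -
  have idI: "ideal I R" and rad: "ideal_radical R I = m" using I unfolding primary_to_def by blast+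
  have "\<forall>a\<in>m. \<exists>n::nat. a [^] n \<in> I" using rad unfolding ideal_radical_def by blast
  then obtain c where c: "ideal_pow R m c \<subseteq> I"
    using power_subset_of_radical[OF ideal_m idI] by blast
  have Im: "I \<subseteq> m"
  proof
    fix a assume a: "a \<in> I"
    have "a \<in> carrier R" by (rule ideal.Icarr[OF idI a])
    then have "a [^] (1::nat) \<in> I" "a \<in> carrier R" using a by simp_all
    then show "a \<in> m" unfolding rad[symmetric] ideal_radical_def by blast
  qed
  have redJ: "is_reduction R J I" and minJ: "\<And>Q'. is_reduction R Q' I \<Longrightarrow> Q' \<subseteq> J \<Longrightarrow> Q' = J"
    using J unfolding is_minimal_reduction_def by blast+
  have idJ: "ideal J R" and JI: "J \<subseteq> I" using redJ unfolding is_reduction_def by blast+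
  have Jm: "J \<subseteq> m" using JI Im by blast
  obtain r where r: "ideal_pow R I r \<subseteq> J" using is_reduction_contains_power[OF idI redJ] by blast
  have cJ: "ideal_pow R m (c * r) \<subseteq> J"
    using ideal_pow_mono[OF c, of r, unfolded ideal_pow_mult[OF ideal_m]] r by (rule order_trans)
  obtain e where e: "len J (carrier R) = enat e"
    using len_finite[OF idJ cJ] by (cases "len J (carrier R)") auto
  have qe: "the_enat (quot_length R J) = e" using quot_length_eq_len[OF idJ] e by simp
  have JR: "J \<subseteq> carrier R" "m \<subseteq> carrier R" by (rule ideal_subset_carrier, rule idJ ideal_m)+
  have "1 \<le> len J (carrier R)"
    by (rule len_pos[OF idJ oneideal]) (use Jm JR m_proper(1) in blast)
  then have e1: "1 \<le> e" using e by (simp add: one_enat_def)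
  show ?thesis
  \<comment> \<open>For e = 1 the expression in the bound is 1 - d \<le> 0, so the reduction number
    must vanish.\<close>
  proof (cases "e = 1")
    case True
    then have "len J (carrier R) \<le> 1" using e by (simp add: one_enat_def)
    then have "m = J"
      using len_1_cases[OF idJ ideal_m oneideal Jm JR(2)] m_proper(1) by blast
    then have "J = I" using JI Im by blast
    then have "ideal_pow R I (Suc 0) = J \<cdot> ideal_pow R I 0" by simp
    then have "reduction_number R J I \<le> 0"
      unfolding reduction_number_def by (rule Least_le)
    then show ?thesis using J by (intro exI[of _ J]) simp
  next
    case False
    then have e2: "2 \<le> e" using e1 by simp
    define s where "s = (LEAST s. primary_gens s)"
    obtain s0 where s0: "s0 \<le> d" "primary_gens s0"
      using exists_system_of_parameters[OF dim(1)] by blast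
    have sg: "primary_gens s" unfolding s_def using s0(2) by (rule LeastI)
    have "s \<le> s0" unfolding s_def using s0(2) by (rule Least_le)
    then have sd: "s \<le> d" using s0(1) by simp
    have min: "\<not> primary_gens l" if "l < s" for l
      using not_less_Least[of l primary_gens] that unfolding s_def by blast
    have "s \<noteq> 0" using sg not_primary_gens_0[OF dim] by metis
    then obtain p where p: "s = Suc p" by (cases s) auto
    obtain x where x: "\<forall>i<Suc p. x i \<in> J" "is_reduction R (gen_by R x (Suc p)) J"
      using minimal_reduction_generators[OF idJ Jm cJ] sg unfolding p by blast
    \<comment> \<open>A reduction of \<open>J\<close> is one of \<open>I\<close>, so minimality of
      \<open>J\<close> gives equality: \<open>J\<close> has \<open>s\<close> generators and their
      ideal has colength \<open>e\<close>.\<close>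
    have "gen_by R x (Suc p) = J"
      by (rule minJ[OF is_reduction_trans[OF idI redJ x(2)]])
        (use x(2) in \<open>simp add: is_reduction_def\<close>)
    then have ex: "len (gen_by R x (Suc p)) (carrier R) = enat e" using e by simp
    \<comment> \<open>The least exponent with s e < k + 2 s, given e \<ge> 2.\<close>
    define k where "k = s * (e - 2) + 1"
    obtain f where f: "e = f + 2" using e2 le_Suc_ex by (metis add.commute)
    have "Suc p * e < k + 2 * Suc p" unfolding k_def p f by simp
    then obtain y where y: "range y \<subseteq> I"
      "ideal_pow R I (Suc k) = gen_by R y (Suc p) \<cdot> ideal_pow R I k"
      using reduction_of_generators[OF idI Im _ c ex] x(1) JI by blast
    let ?Q = "gen_by R y s"
    have "?Q \<subseteq> I" by (rule gen_by_least[OF idI]) (use y(1) in blast)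
    moreover have "ideal ?Q R"
      by (rule span_by_ideal[OF _ oneideal]) (use y(1) ideal_subset_carrier[OF idI] in blast)
    ultimately have redQ: "is_reduction R ?Q I"
      unfolding is_reduction_def using y(2) p by blast
    have "is_minimal_reduction R ?Q I"
      by (rule primary_reduction_minimal[OF idI Im c _ min redQ]) (use y(1) in blast)+
    moreover have "int (reduction_number R ?Q I)
        \<le> max (int d * int (the_enat (quot_length R J)) - 2 * int d + 1) 0"
    proof -
      have "reduction_number R ?Q I \<le> k"
        unfolding reduction_number_def using y(2) p by (intro Least_le) simp
      \<comment> \<open>The passage from \<open>s\<close> to \<open>d\<close>, valid because f = e -
        2 is nonnegative.\<close>
      also have "k \<le> d * f + 1" unfolding k_def f using sd by simp
      finally have "int (reduction_number R ?Q I) \<le> int d * int f + 1"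
        by (metis of_nat_1 of_nat_add of_nat_le_iff of_nat_mult)
      also have "\<dots> = int d * int e - 2 * int d + 1" unfolding f by (simp add: algebra_simps)
      finally show ?thesis unfolding qe by simp
    qed
    ultimately show ?thesis by blast
  qed
qed

end

theorem theorem3p3:
  fixes R :: "('a, 'b) ring_scheme" and m I J :: "'a set" and d :: nat
  assumes "noetherian_ring R"
    and "local_ring R m"
    and "krull_dim R = enat d" and "d \<ge> 1"
    and "infinite (carrier (R Quot m))"
    and "primary_to R m I"
    and "is_minimal_reduction R J I"
  shows "\<exists>Q. is_minimal_reduction R Q I \<and>
           int (reduction_number R Q I)
             \<le> max (int d * int (the_enat (quot_length R J)) - 2 * int d + 1) 0"
proof -
  interpret noetherian_local_ring_inf R m
  proof (intro noetherian_local_ring_inf.intro noetherian_local_ring.intro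
      noetherian_local_ring_axioms.intro noetherian_local_ring_inf_axioms.intro)
    show "noetherian_ring R" by (rule assms(1))
    show "cring R" using assms(2) unfolding local_ring_def by blast
    show "maximalideal m R" using assms(2) unfolding local_ring_def by blast
    show "M = m" if "maximalideal M R" for M
      using assms(2) that unfolding local_ring_def by blast
    show "infinite (carrier (R Quot m))" by (rule assms(5))
  qed
  show ?thesis by (rule exists_minimal_reduction_bound[OF assms(3,4,6,7)])
qed

end
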